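(* Let $\mu\in\mathcal M_+(\mathbb T)$ and $m\in\mathbb N$. If $\alpha>\frac12$, then there exists a constant $\kappa>0$ such that $$D_{\mu,m}(\sigma_n^{\alpha}[f])\leqslant \kappa\, D_{\mu,m}(f)\quad\text{for every } n\in\mathbb N \text{ and every } f\in\mathcal H_{\mu,m}.$$ Moreover, for every $f\in\mathcal H_{\mu,m}$, $D_{\mu,m}\big(\sigma_n^{\alpha}[f]-f\big)\to 0$ as $n\to\infty$.
   Context: $\mathbb N$ is the set of positive integers, $\mathbb D$ the open unit disc and $\mathbb T$ the unit circle in $\mathbb C$; $\mathcal O(\mathbb D)$ is the space of holomorphic functions on $\mathbb D$; $\mathcal M_+(\mathbb T)$ is the set of finite non-negative Borel measures on $\mathbb T$. For $\mu\in\mathcal M_+(\mathbb T)$, $m\in\mathbb N$ and $f\in\mathcal O(\mathbb D)$, the weighted Dirichlet-type integral of $f$ of order $m$ is $$D_{\mu,m}(f)=\frac{1}{m!(m-1)!}\int_{\mathbb D}|f^{(m)}(z)|^2P_\mu(z)(1-|z|^2)^{m-1}\,dA(z),\qquad P_\mu(z)=\int_{\mathbb T}\frac{1-|z|^2}{|z-\zeta|^2}\,d\mu(\zeta),$$ where $dA$ is Lebesgue area measure on $\mathbb D$ normalized so that $\mathbb D$ has measure $1$ and $f^{(m)}$ is the $m$-th derivative. For $\mu\neq0$, $\mathcal H_{\mu,m}=\{f\in\mathcal O(\mathbb D):D_{\mu,m}(f)<\infty\}$; for $\mu=0$, $\mathcal H_{\mu,m}=H^2$, the Hardy space on $\mathbb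 D$. For $f(z)=\sum_{k\ge0}a_kz^k\in\mathcal O(\mathbb D)$, $\alpha\geqslant0$ and an integer $n\geqslant 0$, the generalized $n$-th Cesàro mean is $$\sigma_n^\alpha[f](z)=\binom{n+\alpha}{\alpha}^{-1}\sum_{k=0}^n\binom{n-k+\alpha}{\alpha}a_kz^k,\qquad \binom{j+\alpha}{\alpha}:=\frac{\Gamma(j+\alpha+1)}{\Gamma(\alpha+1)\Gamma(j+1)}.$$ *)

theory Defs
  imports "HOL-Complex_Analysis.Complex_Analysis"
begin

text \<open>
  Holomorphic functions on the open unit disc are total functions \<open>complex \<Rightarrow> complex\<close> that are
  holomorphic on \<open>ball 0 1\<close>; nothing below depends on their values off the disc.
  Integrals of non-negative functions take values in \<^typ>\<open>ennreal\<close>, so \<open>\<infinity>\<close> is a genuine value.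
\<close>

definition circle_measures :: "complex measure set" where
  "circle_measures = {\<mu>. finite_measure \<mu> \<and> sets \<mu> = sets (restrict_space borel (sphere 0 1))}"

definition poisson_integral :: "complex measure \<Rightarrow> complex \<Rightarrow> ennreal" where
  "poisson_integral \<mu> z = (\<integral>\<^sup>+ \<zeta>. ennreal ((1 - (cmod z)\<^sup>2) / (cmod (z - \<zeta>))\<^sup>2) \<partial>\<mu>)"

text \<open>
  The measure \<open>uniform_measure lborel (ball 0 1)\<close> is normalized area measure on the disc. Restricting
  the domain of integration to \<open>ball 0 1\<close> as well cuts off the irrelevant (and possibly
  non-measurable) values of the integrand off the disc. The order \<open>m\<close> is meant to be positive.
\<close>

definition dirichlet_integral :: "complex measure \<Rightarrow> nat \<Rightarrow> (complex \<Rightarrow> complex) \<Rightarrow> ennreal" where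
  "dirichlet_integral \<mu> m f =
     ennreal (1 / (fact m * fact (m - 1))) *
     (\<integral>\<^sup>+ z \<in> ball 0 1.
        ennreal ((cmod ((deriv ^^ m) f z))\<^sup>2) * poisson_integral \<mu> z *
        ennreal ((1 - (cmod z)\<^sup>2) ^ (m - 1))
      \<partial>uniform_measure lborel (ball 0 1))"

definition hardy_H2 :: "(complex \<Rightarrow> complex) set" where
  "hardy_H2 = {f. f holomorphic_on ball 0 1 \<and>
     (SUP r \<in> {0..<1::real}.
        ennreal (1 / (2 * pi)) *
        (\<integral>\<^sup>+ t \<in> {0..2 * pi}. ennreal ((cmod (f (of_real r * cis t)))\<^sup>2) \<partial>lborel)) < \<infinity>}"

definition dirichlet_space :: "complex measure \<Rightarrow> nat \<Rightarrow> (complex \<Rightarrow> complex) set" where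
  "dirichlet_space \<mu> m =
     (if \<mu> = null_measure \<mu> then hardy_H2
      else {f. f holomorphic_on ball 0 1 \<and> dirichlet_integral \<mu> m f < \<infinity>})"

text \<open>The binomial coefficient ``\<open>j + \<alpha>\<close> choose \<open>\<alpha>\<close>''.\<close>

definition cesaro_binomial :: "real \<Rightarrow> nat \<Rightarrow> real" where
  "cesaro_binomial \<alpha> j = Gamma (real j + \<alpha> + 1) / (Gamma (\<alpha> + 1) * Gamma (real j + 1))"

definition cesaro_mean :: "real \<Rightarrow> nat \<Rightarrow> (complex \<Rightarrow> complex) \<Rightarrow> complex \<Rightarrow> complex" where
  "cesaro_mean \<alpha> n f z =
     inverse (of_real (cesaro_binomial \<alpha> n)) *
     (\<Sum>k\<le>n. of_real (cesaro_binomial \<alpha> (n - k)) * fps_nth (fps_expansion f 0) k * z ^ k)"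

end

theory Submission
  imports Defs
begin

text \<open>
  Expand \<open>1 / (cmod (z - \<zeta>))\<^sup>2\<close> in the Poisson kernel as \<open>1 / (cmod (1 - cnj \<zeta> * z))\<^sup>2\<close>. By Tonelli and
  Parseval on the disc with weight \<open>(1 - (cmod z)\<^sup>2) ^ m\<close>, the Dirichlet-type integral is, up to a
  constant, the \<open>\<mu>\<close>-integral over \<open>\<zeta>\<close> of \<open>\<Sum>k. w k * (cmod (H k))\<^sup>2\<close>, where \<open>w k = Beta (k + 1) (m + 1)\<close>
  and \<open>H k = (\<Sum>j\<le>k. b j * \<zeta> ^ j)\<close> for the Taylor coefficients \<open>b\<close> of the \<open>m\<close>-th derivative.
  Cesaro means multiply \<open>b\<close> by a decreasing sequence \<open>e\<close>; summation by parts turns \<open>H k\<close> into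
  \<open>e k * H k + (\<Sum>j<k. d j * H j)\<close> with \<open>d j = e j - e (j + 1)\<close>, and Cauchy-Schwarz gives
  boundedness as soon as \<open>\<Sum>j. (d j)\<^sup>2\<close> is \<open>O(1 / n)\<close>, which is where \<open>\<alpha> > 1 / 2\<close> enters.
  Convergence holds for finitely supported \<open>H\<close>, hence by boundedness for every \<open>\<zeta>\<close> at which the
  series is finite, and passes to the \<open>\<mu>\<close>-integral by dominated convergence.
\<close>

subsection \<open>Cesaro weights\<close>

lemma cesaro_binomial_0: "\<alpha> > -1 \<Longrightarrow> cesaro_binomial \<alpha> 0 = 1"
  using Gamma_real_pos[of "\<alpha> + 1"] by (simp add: cesaro_binomial_def less_imp_neq[symmetric])

lemma cesaro_binomial_Suc:
  assumes "\<alpha> > -1"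
  shows "cesaro_binomial \<alpha> (Suc n) = cesaro_binomial \<alpha> n * (real (Suc n) + \<alpha>) / real (Suc n)"
proof -
  have "real n + \<alpha> + 1 \<notin> \<int>\<^sub>\<le>\<^sub>0" "real n + 1 \<notin> \<int>\<^sub>\<le>\<^sub>0"
    using assms by (auto elim!: nonpos_Ints_cases)
  then show ?thesis
    using Gamma_plus1[of "real n + \<alpha> + 1"] Gamma_plus1[of "real n + 1"]
    by (simp add: cesaro_binomial_def algebra_simps)
qed

lemma cesaro_binomial_pos: "\<alpha> > -1 \<Longrightarrow> cesaro_binomial \<alpha> n > 0"
  by (simp add: cesaro_binomial_def Gamma_real_pos)

text \<open>The summands are the squared increments of the binomials: by
  \<open>cesaro_binomial_Suc\<close>, going from index \<open>i - 1\<close> to \<open>i > 0\<close>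
  adds \<open>cesaro_binomial \<alpha> i * \<alpha> / (i + \<alpha>)\<close>, and at
  \<open>i = 0\<close> the term is 1. An explicit constant lets induction do the work of
  asymptotics.\<close>

lemma sum_cesaro_binomial_squares_le:
  assumes "\<alpha> > 1 / 2"
  shows "(\<Sum>i\<le>n. (cesaro_binomial \<alpha> i * \<alpha> / (real i + \<alpha>))\<^sup>2)
           \<le> (1 + \<alpha>\<^sup>2 / (2 * \<alpha> - 1)) * (cesaro_binomial \<alpha> n)\<^sup>2 / real (Suc n)"
proof (induction n)
  case 0
  then show ?case using assms cesaro_binomial_0[of \<alpha>] by simp
next
  case (Suc n)
  define C where "C = 1 + \<alpha>\<^sup>2 / (2 * \<alpha> - 1)"
  define A where "A = cesaro_binomial \<alpha> (Suc n)"
  define x where "x = real (Suc n)"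
  have x: "x > 0" by (simp add: x_def)
  have xa: "x + \<alpha> > 0" using x assms by simp
  have A': "cesaro_binomial \<alpha> n = A * x / (x + \<alpha>)"
    using cesaro_binomial_Suc[of \<alpha> n] assms xa x by (simp add: A_def x_def)
  \<comment> \<open>These two properties are all that the induction step uses of \<open>C\<close>;
    the second can be met by a finite \<open>C\<close> because \<open>2 * \<alpha> - 1\<close> is
    positive.\<close>
  have C: "C \<ge> 1" "C * (2 * \<alpha> - 1) \<ge> \<alpha>\<^sup>2"
    using assms by (auto simp: C_def distrib_right)
  \<comment> \<open>With denominators cleared, both sides of the induction step are linear in
    \<open>x\<close>; the bounds on \<open>C\<close> compare the coefficients of \<open>x\<close>
    and the constant terms separately.\<close>
  have "C * ((x + \<alpha>)\<^sup>2 - x * (x + 1)) = (C * (2 * \<alpha> - 1)) * x + C * \<alpha>\<^sup>2"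
    by (simp add: power2_eq_square algebra_simps)
  also have "\<dots> \<ge> \<alpha>\<^sup>2 * x + 1 * \<alpha>\<^sup>2"
    using C x by (intro add_mono mult_right_mono) auto
  finally have "\<alpha>\<^sup>2 * (x + 1) \<le> C * ((x + \<alpha>)\<^sup>2 - x * (x + 1))"
    by (simp add: algebra_simps)
  then have "C * x / (x + \<alpha>)\<^sup>2 + \<alpha>\<^sup>2 / (x + \<alpha>)\<^sup>2 \<le> C / (x + 1)"
    using x xa by (simp add: field_simps)
  then have "A\<^sup>2 * (C * x / (x + \<alpha>)\<^sup>2 + \<alpha>\<^sup>2 / (x + \<alpha>)\<^sup>2) \<le> A\<^sup>2 * (C / (x + 1))"
    by (intro mult_left_mono) auto
  moreover have "C * (A * x / (x + \<alpha>))\<^sup>2 / x + (A * \<alpha> / (x + \<alpha>))\<^sup>2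
      = A\<^sup>2 * (C * x / (x + \<alpha>)\<^sup>2 + \<alpha>\<^sup>2 / (x + \<alpha>)\<^sup>2)"
    using x xa by (simp add: power_divide power_mult_distrib distrib_left power2_eq_square[of x])
  moreover have "(\<Sum>i\<le>n. (cesaro_binomial \<alpha> i * \<alpha> / (real i + \<alpha>))\<^sup>2) \<le> C * (A * x / (x + \<alpha>))\<^sup>2 / x"
    using Suc.IH unfolding A' C_def x_def .
  moreover have "(\<Sum>i\<le>Suc n. (cesaro_binomial \<alpha> i * \<alpha> / (real i + \<alpha>))\<^sup>2)
      = (\<Sum>i\<le>n. (cesaro_binomial \<alpha> i * \<alpha> / (real i + \<alpha>))\<^sup>2) + (A * \<alpha> / (x + \<alpha>))\<^sup>2"
    by (simp add: A_def x_def)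
  moreover have "A\<^sup>2 * (C / (x + 1)) = C * A\<^sup>2 / real (Suc (Suc n))"
    by (simp add: x_def)
  ultimately show ?case
    unfolding C_def[symmetric] A_def[symmetric] by linarith
qed

text \<open>The factor by which the Cesaro mean multiplies the \<open>k\<close>-th Taylor
  coefficient. Because of the zero branch, the jump after \<open>k = n\<close> is counted among the
  consecutive differences.\<close>

definition cesaro_weight :: "real \<Rightarrow> nat \<Rightarrow> nat \<Rightarrow> real" where
  "cesaro_weight \<alpha> n k =
     (if k \<le> n then cesaro_binomial \<alpha> (n - k) / cesaro_binomial \<alpha> n else 0)"

lemma cesaro_weight_0: "\<alpha> > -1 \<Longrightarrow> cesaro_weight \<alpha> n 0 = 1"
  using cesaro_binomial_pos[of \<alpha> n] by (simp add: cesaro_weight_def)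

lemma cesaro_weight_nonneg: "\<alpha> > -1 \<Longrightarrow> cesaro_weight \<alpha> n k \<ge> 0"
  using cesaro_binomial_pos[of \<alpha>] by (simp add: cesaro_weight_def less_imp_le)

text \<open>The recurrence of the binomials, read downwards. At \<open>k = n\<close> the fraction
  \<open>\<alpha> / (0 + \<alpha>)\<close> equals 1, which accounts for the jump to zero.\<close>

lemma cesaro_weight_diff:
  assumes "\<alpha> > 0" "k \<le> n"
  shows "cesaro_weight \<alpha> n k - cesaro_weight \<alpha> n (Suc k)
           = cesaro_binomial \<alpha> (n - k) * \<alpha> / (real (n - k) + \<alpha>) / cesaro_binomial \<alpha> n"
proof (cases "k = n")
  case True
  then show ?thesis using assms by (simp add: cesaro_weight_def)
next
  case False
  then obtain i where i: "n - k = Suc i" "n - Suc k = i"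
    using assms by (metis Suc_diff_Suc le_neq_implies_less)
  have "real (Suc i) + \<alpha> > 0" using assms by simp
  then have "cesaro_binomial \<alpha> i
      = cesaro_binomial \<alpha> (Suc i) * real (Suc i) / (real (Suc i) + \<alpha>)"
    using assms cesaro_binomial_Suc[of \<alpha> i] by (simp add: field_simps del: of_nat_Suc)
  moreover have "A - A * x / (x + \<alpha>) = A * \<alpha> / (x + \<alpha>)" if "x > 0" for A x :: real
    using that assms by (simp add: field_simps)
  ultimately have "cesaro_binomial \<alpha> (Suc i) - cesaro_binomial \<alpha> i
      = cesaro_binomial \<alpha> (Suc i) * \<alpha> / (real (Suc i) + \<alpha>)" by simp
  with False assms i show ?thesis
    by (simp add: cesaro_weight_def diff_divide_distrib[symmetric] del: of_nat_Suc)
qed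

lemma cesaro_weight_antimono:
  assumes "\<alpha> > 0"
  shows "cesaro_weight \<alpha> n (Suc k) \<le> cesaro_weight \<alpha> n k"
proof (cases "k \<le> n")
  case True
  have "0 \<le> cesaro_binomial \<alpha> (n - k) * \<alpha> / (real (n - k) + \<alpha>) / cesaro_binomial \<alpha> n"
    using assms cesaro_binomial_pos[of \<alpha>]
    by (intro divide_nonneg_nonneg mult_nonneg_nonneg) (auto simp: less_imp_le)
  then show ?thesis
    unfolding cesaro_weight_diff[OF assms True, symmetric] by (simp only: diff_ge_0_iff_ge)
qed (simp add: cesaro_weight_def)

lemma cesaro_weight_le_1:
  assumes "\<alpha> > 0" shows "cesaro_weight \<alpha> n k \<le> 1"
  using lift_Suc_antimono_le[of "cesaro_weight \<alpha> n" 0 k] cesaro_weight_antimono[OF assms]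
    cesaro_weight_0[of \<alpha> n] assms by auto

text \<open>Reversing the summation by \<open>i = n - k\<close> gives the sum of
  \<open>sum_cesaro_binomial_squares_le\<close>, divided by the square of
  \<open>cesaro_binomial \<alpha> n\<close>, which cancels.\<close>

lemma sum_cesaro_weight_diff_squares_le:
  assumes "\<alpha> > 1 / 2"
  shows "(\<Sum>k\<le>n. (cesaro_weight \<alpha> n k - cesaro_weight \<alpha> n (Suc k))\<^sup>2)
           \<le> (1 + \<alpha>\<^sup>2 / (2 * \<alpha> - 1)) / real (Suc n)"
proof -
  have pos: "cesaro_binomial \<alpha> n > 0" using assms by (simp add: cesaro_binomial_pos)
  have "(\<Sum>k\<le>n. (cesaro_weight \<alpha> n k - cesaro_weight \<alpha> n (Suc k))\<^sup>2)
      = (\<Sum>k\<le>n. (cesaro_binomial \<alpha> (n - k) * \<alpha> / (real (n - k) + \<alpha>))\<^sup>2 / (cesaro_binomial \<alpha> n)\<^sup>2)"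
    by (intro sum.cong refl, subst cesaro_weight_diff) (use assms in \<open>simp, simp, simp only: power_divide\<close>)
  also have "\<dots> = (\<Sum>i\<le>n. (cesaro_binomial \<alpha> i * \<alpha> / (real i + \<alpha>))\<^sup>2 / (cesaro_binomial \<alpha> n)\<^sup>2)"
    by (rule sum.nat_diff_reindex[of _ "Suc n", simplified lessThan_Suc_atMost, simplified])
  also have "\<dots> \<le> (1 + \<alpha>\<^sup>2 / (2 * \<alpha> - 1)) * (cesaro_binomial \<alpha> n)\<^sup>2 / real (Suc n)
      / (cesaro_binomial \<alpha> n)\<^sup>2"
    unfolding sum_divide_distrib[symmetric]
    by (intro divide_right_mono sum_cesaro_binomial_squares_le assms) simp
  also have "\<dots> = (1 + \<alpha>\<^sup>2 / (2 * \<alpha> - 1)) / real (Suc n)"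
    using pos by simp
  finally show ?thesis .
qed

text \<open>The weight at 0 is 1, and each consecutive difference tends to 0 because its square is
  one term of a sum that is O(1/n). Induction on \<open>k\<close> adds up these differences.\<close>

lemma cesaro_weight_tendsto_1:
  assumes "\<alpha> > 1 / 2"
  shows "(\<lambda>n. cesaro_weight \<alpha> n k) \<longlonglongrightarrow> 1"
proof (induction k)
  case 0
  then show ?case using assms by (simp add: cesaro_weight_0)
next
  case (Suc k)
  define C where "C = 1 + \<alpha>\<^sup>2 / (2 * \<alpha> - 1)"
  define d where "d = (\<lambda>n. cesaro_weight \<alpha> n k - cesaro_weight \<alpha> n (Suc k))"
  have "(\<lambda>n. (d n)\<^sup>2) \<longlonglongrightarrow> 0"
  proof (rule tendsto_sandwich[of "\<lambda>_. 0"])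
    show "eventually (\<lambda>n. (d n)\<^sup>2 \<le> C / real (Suc n)) sequentially"
      using eventually_ge_at_top[of k]
    proof eventually_elim
      case (elim n)
      then have "(d n)\<^sup>2 \<le> (\<Sum>k\<le>n. (cesaro_weight \<alpha> n k - cesaro_weight \<alpha> n (Suc k))\<^sup>2)"
        unfolding d_def by (intro member_le_sum) auto
      with sum_cesaro_weight_diff_squares_le[OF assms, of n] show ?case by (simp add: C_def)
    qed
    show "(\<lambda>n. C / real (Suc n)) \<longlonglongrightarrow> 0"
      using LIMSEQ_Suc[OF lim_const_over_n[of C]] by simp
  qed auto
  then have "d \<longlonglongrightarrow> 0" by (simp add: power_tendsto_0_iff)
  from tendsto_diff[OF Suc this] show ?case by (simp add: d_def)
qed

subsection \<open>Multipliers on partial sums\<close>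

lemma sum_scaleR_by_parts:
  fixes e :: "nat \<Rightarrow> real" and b :: "nat \<Rightarrow> 'a::real_vector"
  shows "(\<Sum>j\<le>k. e j *\<^sub>R b j)
           = e k *\<^sub>R (\<Sum>j\<le>k. b j) + (\<Sum>j<k. (e j - e (Suc j)) *\<^sub>R (\<Sum>i\<le>j. b i))"
  by (induction k) (simp_all add: algebra_simps)

lemma norm_add_squared_le:
  fixes x y :: "'a::real_normed_vector"
  shows "(norm (x + y))\<^sup>2 \<le> 2 * (norm x)\<^sup>2 + 2 * (norm y)\<^sup>2"
proof -
  have "(norm (x + y))\<^sup>2 \<le> (norm x + norm y)\<^sup>2"
    by (intro power_mono norm_triangle_ineq) auto
  also have "\<dots> \<le> 2 * (norm x)\<^sup>2 + 2 * (norm y)\<^sup>2"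
    using sum_squares_bound[of "norm x" "norm y"] by (simp add: power2_sum)
  finally show ?thesis .
qed

text \<open>Summation by parts splits the new partial sum into \<open>e k\<close> times the old one
  and a remainder \<open>T k\<close>. Weighted Cauchy-Schwarz bounds \<open>T k\<close> by
  \<open>S\<close> times the sum of squared differences, at the price of a reciprocal weight. Summed
  over \<open>k\<close>, these prices grow like \<open>Suc n\<close> and cancel the decay
  \<open>C / Suc n\<close>.\<close>

lemma sum_multiplier_le:
  fixes w e :: "nat \<Rightarrow> real" and b :: "nat \<Rightarrow> 'a::real_normed_vector"
  assumes w: "\<And>k. w k > 0" "decseq w"
    and tail: "\<And>N. (\<Sum>k\<in>{n<..<N}. w k) \<le> B * real (Suc n) * w n"
    and e: "\<And>k. 0 \<le> e k" "\<And>k. e k \<le> 1" "\<And>k. n < k \<Longrightarrow> e k = 0"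
    and C: "(\<Sum>k\<le>n. (e k - e (Suc k))\<^sup>2) \<le> C / real (Suc n)"
  shows "(\<Sum>k<N. w k * (norm (\<Sum>j\<le>k. e j *\<^sub>R b j))\<^sup>2)
           \<le> (2 + 2 * C * (1 + B)) * (\<Sum>k<N. w k * (norm (\<Sum>j\<le>k. b j))\<^sup>2)"
proof -
  define H where "H = (\<lambda>k. \<Sum>j\<le>k. b j)"
  define d where "d = (\<lambda>k. e k - e (Suc k))"
  define T where "T = (\<lambda>k. \<Sum>j<k. d j *\<^sub>R H j)"
  define S where "S = (\<Sum>k<N. w k * (norm (H k))\<^sup>2)"
  have S: "S \<ge> 0" unfolding S_def using w by (intro sum_nonneg) (simp add: less_imp_le)
  have "0 \<le> C / real (Suc n)" using C by (rule order_trans[rotated]) (auto intro: sum_nonneg)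
  then have C0: "C \<ge> 0" by (simp add: zero_le_divide_iff)
  have dz: "d j = 0" if "n < j" for j
    using that e(3)[of j] e(3)[of "Suc j"] by (simp add: d_def)
  \<comment> \<open>Only \<open>j < k\<close> with \<open>j \<le> n\<close> contribute, and a
    decreasing \<open>w\<close> has its least value among them bounded below by
    \<open>w (min k n)\<close>.\<close>
  have T: "w k * (norm (T k))\<^sup>2 \<le> S * (C / real (Suc n)) * (w k / w (min k n))" if "k < N" for k
  proof -
    \<comment> \<open>The factor \<open>sqrt (w j)\<close> is moved so that Cauchy-Schwarz
      reproduces the weighted sum \<open>S\<close>.\<close>
    let ?u = "\<lambda>j. \<bar>d j\<bar> / sqrt (w j)" and ?v = "\<lambda>j. sqrt (w j) * norm (H j)"
    have "norm (T k) \<le> (\<Sum>j<k. \<bar>d j\<bar> * norm (H j))"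
      unfolding T_def by (intro sum_norm_le) simp
    also have "\<dots> = (\<Sum>j<k. ?u j * ?v j)"
      using w(1) by (intro sum.cong) (auto simp: less_imp_neq[symmetric])
    finally have "(norm (T k))\<^sup>2 \<le> (\<Sum>j<k. ?u j * ?v j)\<^sup>2" by (intro power_mono) auto
    also have "\<dots> \<le> (\<Sum>j<k. (?u j)\<^sup>2) * (\<Sum>j<k. (?v j)\<^sup>2)"
      by (rule Cauchy_Schwarz_ineq_sum)
    also have "\<dots> \<le> (C / real (Suc n) / w (min k n)) * S"
    proof (intro mult_mono)
      have "(\<Sum>j<k. (?u j)\<^sup>2) = (\<Sum>j\<in>{..<k} \<inter> {..n}. (?u j)\<^sup>2)"
        using dz by (intro sum.mono_neutral_right) (auto simp flip: not_less)
      also have "\<dots> \<le> (\<Sum>j\<in>{..<k} \<inter> {..n}. (d j)\<^sup>2 / w (min k n))"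
      proof (intro sum_mono)
        fix j assume "j \<in> {..<k} \<inter> {..n}"
        then have "w (min k n) \<le> w j" using w(2) by (auto simp: decseq_def)
        then show "(?u j)\<^sup>2 \<le> (d j)\<^sup>2 / w (min k n)"
          using w(1) by (auto simp: power_divide less_imp_le intro!: divide_left_mono)
      qed
      also have "\<dots> \<le> (\<Sum>j\<le>n. (d j)\<^sup>2 / w (min k n))"
        using w(1) by (intro sum_mono2) (auto simp: less_imp_le)
      also have "\<dots> \<le> C / real (Suc n) / w (min k n)"
        using w(1) C unfolding sum_divide_distrib[symmetric] d_def
        by (intro divide_right_mono) (auto simp: less_imp_le)
      finally show "(\<Sum>j<k. (?u j)\<^sup>2) \<le> C / real (Suc n) / w (min k n)" .
      have "(\<Sum>j<k. (?v j)\<^sup>2) = (\<Sum>j<k. w j * (norm (H j))\<^sup>2)"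
        using w(1) by (simp add: power_mult_distrib less_imp_le)
      also have "\<dots> \<le> S" unfolding S_def using that w(1)
        by (intro sum_mono2) (auto simp: less_imp_le)
      finally show "(\<Sum>j<k. (?v j)\<^sup>2) \<le> S" .
    qed (use w(1) C0 S in \<open>auto simp: less_imp_le intro!: sum_nonneg\<close>)
    finally have "w k * (norm (T k))\<^sup>2 \<le> w k * ((C / real (Suc n) / w (min k n)) * S)"
      using w(1) by (intro mult_left_mono) (auto simp: less_imp_le)
    then show ?thesis by (simp add: mult_ac)
  qed
  \<comment> \<open>The ratio is 1 up to \<open>n\<close>, and beyond \<open>n\<close> its sum is
    controlled by \<open>tail\<close>. Enlarging the index set to contain all of
    \<open>{..n}\<close> also covers \<open>N \<le> n\<close>.\<close>
  have "(\<Sum>k<N. w k / w (min k n)) \<le> (\<Sum>k\<in>{..n} \<union> {n<..<N}. w k / w (min k n))"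
    using w(1) by (intro sum_mono2) (auto simp: less_imp_le)
  also have "\<dots> = (\<Sum>k\<le>n. w k / w (min k n)) + (\<Sum>k\<in>{n<..<N}. w k / w (min k n))"
    by (intro sum.union_disjoint) auto
  also have "(\<Sum>k\<le>n. w k / w (min k n)) = (\<Sum>k\<le>n. 1)"
    using w(1) by (intro sum.cong) (auto simp: min_def less_imp_neq[symmetric])
  also have "(\<Sum>k\<in>{n<..<N}. w k / w (min k n)) = (\<Sum>k\<in>{n<..<N}. w k) / w n"
    unfolding sum_divide_distrib by (intro sum.cong) auto
  also have "(\<Sum>k\<in>{n<..<N}. w k) / w n \<le> B * real (Suc n)"
    using tail[of N] w(1)[of n] by (simp add: pos_divide_le_eq)
  finally have R: "(\<Sum>k<N. w k / w (min k n)) \<le> (1 + B) * real (Suc n)"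
    by (simp add: algebra_simps)
  have "(\<Sum>k<N. w k * (norm (\<Sum>j\<le>k. e j *\<^sub>R b j))\<^sup>2) = (\<Sum>k<N. w k * (norm (e k *\<^sub>R H k + T k))\<^sup>2)"
    by (simp add: sum_scaleR_by_parts[of e] H_def T_def d_def)
  also have "\<dots> \<le> (\<Sum>k<N. 2 * (w k * (norm (H k))\<^sup>2) + 2 * (w k * (norm (T k))\<^sup>2))"
  proof (rule sum_mono)
    fix k
    have "(norm (e k *\<^sub>R H k))\<^sup>2 \<le> (norm (H k))\<^sup>2"
      using e(1,2)[of k] by (intro power_mono) (auto simp: mult_left_le_one_le)
    then have "(norm (e k *\<^sub>R H k + T k))\<^sup>2 \<le> 2 * (norm (H k))\<^sup>2 + 2 * (norm (T k))\<^sup>2"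
      using norm_add_squared_le[of "e k *\<^sub>R H k" "T k"] by linarith
    then have "w k * (norm (e k *\<^sub>R H k + T k))\<^sup>2
        \<le> w k * (2 * (norm (H k))\<^sup>2 + 2 * (norm (T k))\<^sup>2)"
      using w(1) by (intro mult_left_mono) (auto simp: less_imp_le)
    then show "w k * (norm (e k *\<^sub>R H k + T k))\<^sup>2
        \<le> 2 * (w k * (norm (H k))\<^sup>2) + 2 * (w k * (norm (T k))\<^sup>2)"
      by (simp add: algebra_simps)
  qed
  also have "\<dots> = 2 * S + 2 * (\<Sum>k<N. w k * (norm (T k))\<^sup>2)"
    by (simp add: S_def sum.distrib sum_distrib_left)
  also have "(\<Sum>k<N. w k * (norm (T k))\<^sup>2) \<le> (\<Sum>k<N. S * (C / real (Suc n)) * (w k / w (min k n)))"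
    by (intro sum_mono T) auto
  also have "\<dots> = S * (C / real (Suc n)) * (\<Sum>k<N. w k / w (min k n))"
    by (simp add: sum_distrib_left)
  also have "\<dots> \<le> S * (C / real (Suc n)) * ((1 + B) * real (Suc n))"
    using S C0 by (intro mult_left_mono R) auto
  also have "\<dots> = S * C * (1 + B)" by simp
  finally show ?thesis by (simp add: S_def H_def algebra_simps)
qed

section \<open>Multipliers on infinite series\<close>

lemma suminf_ennreal_le_of_sum_le:
  fixes x y :: "nat \<Rightarrow> real"
  assumes "\<And>k. x k \<ge> 0" "\<And>k. y k \<ge> 0" "K \<ge> 0"
    and le: "\<And>N. (\<Sum>k<N. x k) \<le> K * (\<Sum>k<N. y k)"
  shows "(\<Sum>k. ennreal (x k)) \<le> ennreal K * (\<Sum>k. ennreal (y k))"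
proof (rule suminf_le_const)
  show "(\<Sum>k<N. ennreal (x k)) \<le> ennreal K * (\<Sum>k. ennreal (y k))" for N
  proof -
    have "(\<Sum>k<N. ennreal (x k)) = ennreal (\<Sum>k<N. x k)" using assms by simp
    also have "\<dots> \<le> ennreal (K * (\<Sum>k<N. y k))" by (intro ennreal_leI le)
    also have "\<dots> = ennreal K * (\<Sum>k<N. ennreal (y k))"
      using assms by (simp add: ennreal_mult sum_nonneg)
    also have "\<dots> \<le> ennreal K * (\<Sum>k. ennreal (y k))"
      by (intro mult_left_mono sum_le_suminf) auto
    finally show ?thesis .
  qed
qed simp

lemma suminf_multiplier_le:
  fixes w e :: "nat \<Rightarrow> real" and b :: "nat \<Rightarrow> 'a::real_normed_vector"
  assumes w: "\<And>k. w k > 0" "decseq w"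
    and tail: "\<And>N. (\<Sum>k\<in>{n<..<N}. w k) \<le> B * real (Suc n) * w n" "B \<ge> 0"
    and e: "\<And>k. 0 \<le> e k" "\<And>k. e k \<le> 1" "\<And>k. n < k \<Longrightarrow> e k = 0"
    and C: "(\<Sum>k\<le>n. (e k - e (Suc k))\<^sup>2) \<le> C / real (Suc n)" "C \<ge> 0"
  shows "(\<Sum>k. ennreal (w k * (norm (\<Sum>j\<le>k. e j *\<^sub>R b j))\<^sup>2))
           \<le> ennreal (2 + 2 * C * (1 + B)) * (\<Sum>k. ennreal (w k * (norm (\<Sum>j\<le>k. b j))\<^sup>2))"
  by (intro suminf_ennreal_le_of_sum_le sum_multiplier_le[where n=n] assms)
    (use w tail(2) C(2) in \<open>auto simp: less_imp_le\<close>)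

lemma suminf_ennreal_norm_add_squared_le:
  fixes x y :: "nat \<Rightarrow> 'a::real_normed_vector"
  assumes "\<And>k. w k \<ge> 0"
  shows "(\<Sum>k. ennreal (w k * (norm (x k + y k))\<^sup>2))
           \<le> 2 * (\<Sum>k. ennreal (w k * (norm (x k))\<^sup>2)) + 2 * (\<Sum>k. ennreal (w k * (norm (y k))\<^sup>2))"
proof -
  have "(\<Sum>k. ennreal (w k * (norm (x k + y k))\<^sup>2))
      \<le> (\<Sum>k. 2 * ennreal (w k * (norm (x k))\<^sup>2) + 2 * ennreal (w k * (norm (y k))\<^sup>2))"
  proof (intro suminf_le)
    fix k
    have "w k * (norm (x k + y k))\<^sup>2 \<le> w k * (2 * (norm (x k))\<^sup>2 + 2 * (norm (y k))\<^sup>2)"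
      by (intro mult_left_mono norm_add_squared_le assms)
    then have "ennreal (w k * (norm (x k + y k))\<^sup>2)
        \<le> ennreal (2 * (w k * (norm (x k))\<^sup>2) + 2 * (w k * (norm (y k))\<^sup>2))"
      by (intro ennreal_leI) (simp add: algebra_simps)
    also have "\<dots> = 2 * ennreal (w k * (norm (x k))\<^sup>2) + 2 * ennreal (w k * (norm (y k))\<^sup>2)"
      using assms by (simp add: ennreal_plus ennreal_mult'')
    finally show "ennreal (w k * (norm (x k + y k))\<^sup>2)
        \<le> 2 * ennreal (w k * (norm (x k))\<^sup>2) + 2 * ennreal (w k * (norm (y k))\<^sup>2)" .
  qed auto
  then show ?thesis by (simp add: suminf_add[symmetric])
qed

text \<open>The head is set to zero instead of being shifted away, so that the index keeps its
  meaning; this is the shape of the remainder in \<open>multiplier_tendsto_0\<close>.\<close>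

lemma suminf_ennreal_tail_less:
  fixes x :: "nat \<Rightarrow> real" and \<epsilon> :: real
  assumes "\<And>k. x k \<ge> 0" "(\<Sum>k. ennreal (x k)) < \<infinity>" "\<epsilon> > 0"
  obtains N where "(\<Sum>k. ennreal (if k < N then 0 else x k)) < ennreal \<epsilon>"
proof -
  have sm: "summable x" using assms(1,2) by (intro summable_suminf_not_top) auto
  then obtain N where N: "norm (\<Sum>i. x (i + N)) < \<epsilon>"
    using suminf_exist_split[OF assms(3)] by blast
  have "(\<lambda>k. if k < N then 0 else x k) sums (\<Sum>i. x (i + N))"
    using sm by (subst sums_zero_iff_shift[symmetric, of N]) (auto intro: summable_sums)
  then have "(\<Sum>k. ennreal (if k < N then 0 else x k)) = ennreal (\<Sum>i. x (i + N))"
    using assms(1) by (intro suminf_ennreal_eq) auto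
  also have "\<dots> < ennreal \<epsilon>" using N assms(3) by (intro ennreal_lessI) auto
  finally show ?thesis by (rule that)
qed

text \<open>All perturbed partial sums are bounded by one finite sum that tends to 0. They need not
  vanish for large \<open>k\<close>, so summability of \<open>w\<close> is what bounds the
  series.\<close>

lemma multiplier_finite_tendsto_0:
  fixes e :: "nat \<Rightarrow> nat \<Rightarrow> real" and b :: "nat \<Rightarrow> 'a::real_normed_vector"
  assumes w: "\<And>k. w k \<ge> 0" "summable w"
    and lim: "\<And>k. (\<lambda>n. e n k) \<longlonglongrightarrow> 1" and b: "\<And>k. k > N \<Longrightarrow> b k = 0"
  shows "(\<lambda>n. \<Sum>k. ennreal (w k * (norm (\<Sum>j\<le>k. (e n j - 1) *\<^sub>R b j))\<^sup>2)) \<longlonglongrightarrow> 0"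
proof (rule tendsto_sandwich[of "\<lambda>_. 0"])
  let ?m = "\<lambda>n. \<Sum>j\<le>N. \<bar>e n j - 1\<bar> * norm (b j)"
  show "\<forall>\<^sub>F n in sequentially. (\<Sum>k. ennreal (w k * (norm (\<Sum>j\<le>k. (e n j - 1) *\<^sub>R b j))\<^sup>2))
      \<le> ennreal (suminf w * (?m n)\<^sup>2)"
  proof (intro always_eventually allI)
    fix n
    have "(\<Sum>k. ennreal (w k * (norm (\<Sum>j\<le>k. (e n j - 1) *\<^sub>R b j))\<^sup>2)) \<le> (\<Sum>k. ennreal (w k * (?m n)\<^sup>2))"
    proof (intro suminf_le ennreal_leI mult_left_mono power_mono w)
      fix k
      have "norm (\<Sum>j\<le>k. (e n j - 1) *\<^sub>R b j) \<le> (\<Sum>j\<le>k. \<bar>e n j - 1\<bar> * norm (b j))"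
        by (intro sum_norm_le) simp
      also have "\<dots> = (\<Sum>j\<in>{..k} \<inter> {..N}. \<bar>e n j - 1\<bar> * norm (b j))"
        using b by (intro sum.mono_neutral_right) (auto simp flip: not_less)
      also have "\<dots> \<le> ?m n" by (intro sum_mono2) auto
      finally show "norm (\<Sum>j\<le>k. (e n j - 1) *\<^sub>R b j) \<le> ?m n" .
    qed auto
    also have "\<dots> = ennreal (suminf w * (?m n)\<^sup>2)"
      using w by (intro suminf_ennreal_eq sums_mult2 summable_sums) auto
    finally show "(\<Sum>k. ennreal (w k * (norm (\<Sum>j\<le>k. (e n j - 1) *\<^sub>R b j))\<^sup>2))
      \<le> ennreal (suminf w * (?m n)\<^sup>2)" .
  qed
  have "(\<lambda>n. suminf w * (?m n)\<^sup>2) \<longlonglongrightarrow> suminf w * (\<Sum>j\<le>N. \<bar>1 - 1\<bar> * norm (b j))\<^sup>2"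
    by (intro tendsto_intros lim)
  then show "(\<lambda>n. ennreal (suminf w * (?m n)\<^sup>2)) \<longlonglongrightarrow> 0"
    using tendsto_ennrealI by fastforce
qed auto

text \<open>A density argument: \<open>b\<close> is split into a finitely supported
  \<open>b1\<close>, where convergence is elementary, and a remainder \<open>b2\<close> of small
  weighted sum, which the multipliers enlarge by at most a fixed factor for all
  \<open>n\<close>.\<close>

lemma multiplier_tendsto_0:
  fixes w :: "nat \<Rightarrow> real" and e :: "nat \<Rightarrow> nat \<Rightarrow> real" and b :: "nat \<Rightarrow> 'a::real_normed_vector"
  assumes w: "\<And>k. w k > 0" "decseq w" "summable w"
    and tail: "\<And>n N. (\<Sum>k\<in>{n<..<N}. w k) \<le> B * real (Suc n) * w n" "B \<ge> 0"
    and e: "\<And>n k. 0 \<le> e n k" "\<And>n k. e n k \<le> 1" "\<And>n k. n < k \<Longrightarrow> e n k = 0"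
    and C: "\<And>n. (\<Sum>k\<le>n. (e n k - e n (Suc k))\<^sup>2) \<le> C / real (Suc n)" "C \<ge> 0"
    and lim: "\<And>k. (\<lambda>n. e n k) \<longlonglongrightarrow> 1"
    and fin: "(\<Sum>k. ennreal (w k * (norm (\<Sum>j\<le>k. b j))\<^sup>2)) < \<infinity>"
  shows "(\<lambda>n. \<Sum>k. ennreal (w k * (norm (\<Sum>j\<le>k. (e n j - 1) *\<^sub>R b j))\<^sup>2)) \<longlonglongrightarrow> 0"
proof (rule order_tendstoI)
  fix a :: ennreal assume "0 < a"
  define V where "V = (\<lambda>x :: nat \<Rightarrow> 'a. \<Sum>k. ennreal (w k * (norm (\<Sum>j\<le>k. x j))\<^sup>2))"
  define K where "K = 2 + 2 * C * (1 + B)"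
  have K: "K > 0" using C(2) tail(2) by (simp add: K_def add_pos_nonneg)
  \<comment> \<open>The bound \<open>a\<close> may be infinite, so the estimates use a positive real
    below it.\<close>
  obtain r where r: "0 < r" "ennreal r < a"
  proof -
    obtain q where "0 < ennreal (real_of_rat q)" "ennreal (real_of_rat q) < a"
      using ennreal_rat_dense[OF \<open>0 < a\<close>] by blast
    then show ?thesis using that[of "real_of_rat q"] by simp
  qed
  have V_add: "V (\<lambda>j. x j + y j) \<le> 2 * V x + 2 * V y" for x y
    unfolding V_def sum.distrib
    using w(1) by (intro suminf_ennreal_norm_add_squared_le) (simp add: less_imp_le)
  \<comment> \<open>The remainder will cost \<open>2 * (K + 1)\<close> times this amount, that is
    \<open>r / 4\<close>. Two such quarters, each doubled when \<open>b1\<close> and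
    \<open>b2\<close> are recombined, add up to \<open>r\<close>.\<close>
  obtain N where N: "(\<Sum>k. ennreal (if k < N then 0 else w k * (norm (\<Sum>j\<le>k. b j))\<^sup>2))
      < ennreal (r / (8 * (K + 1)))"
  proof (rule suminf_ennreal_tail_less[OF _ fin])
    show "0 < r / (8 * (K + 1))" using r K by simp
  qed (use w(1) in \<open>auto simp: less_imp_le\<close>)
  \<comment> \<open>The entry at \<open>N\<close> cancels the sum of the earlier ones, so the
    partial sums of \<open>b1\<close>, not merely its entries, vanish from \<open>N\<close> on.
    Those of \<open>b2\<close> then form exactly the tail of the partial sums of
    \<open>b\<close>.\<close>
  define b1 where "b1 = (\<lambda>j. if j < N then b j else if j = N then - (\<Sum>i<N. b i) else 0)"
  define b2 where "b2 = (\<lambda>j. b j - b1 j)"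
  have H1: "(\<Sum>j\<le>k. b1 j) = (if k < N then \<Sum>j\<le>k. b j else 0)" for k
  proof (cases "k < N")
    case False
    have "(\<Sum>j\<le>k. b1 j) = (\<Sum>j\<le>N. b1 j)"
      using False by (intro sum.mono_neutral_right) (auto simp: b1_def)
    also have "\<dots> = (\<Sum>j<N. b1 j) + b1 N" by (simp flip: lessThan_Suc_atMost)
    also have "(\<Sum>j<N. b1 j) = (\<Sum>j<N. b j)" by (simp add: b1_def)
    finally show ?thesis using False by (simp add: b1_def)
  qed (simp add: b1_def)
  have "V b2 = (\<Sum>k. ennreal (if k < N then 0 else w k * (norm (\<Sum>j\<le>k. b j))\<^sup>2))"
    unfolding V_def b2_def by (intro arg_cong[where f=suminf] ext) (simp add: sum_subtractf H1)
  with N have V2: "V b2 < ennreal (r / (8 * (K + 1)))" by simp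
  have "(\<lambda>n. V (\<lambda>j. (e n j - 1) *\<^sub>R b1 j)) \<longlonglongrightarrow> 0"
    unfolding V_def using w lim
    by (intro multiplier_finite_tendsto_0[where N=N]) (auto simp: less_imp_le b1_def)
  then have "eventually (\<lambda>n. V (\<lambda>j. (e n j - 1) *\<^sub>R b1 j) < ennreal (r / 4)) sequentially"
    using r by (intro order_tendstoD) auto
  then show "eventually (\<lambda>n. (\<Sum>k. ennreal (w k * (norm (\<Sum>j\<le>k. (e n j - 1) *\<^sub>R b j))\<^sup>2)) < a) sequentially"
  proof eventually_elim
    case (elim n)
    \<comment> \<open>The factor \<open>e n j - 1\<close> is not in the unit interval, so the
      multiplier bound is applied to \<open>e n\<close> and the term \<open>- b2\<close> is
      estimated separately.\<close>
    have "V (\<lambda>j. (e n j - 1) *\<^sub>R b2 j) = V (\<lambda>j. e n j *\<^sub>R b2 j + (- b2 j))"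
      by (simp add: algebra_simps)
    also have "\<dots> \<le> 2 * V (\<lambda>j. e n j *\<^sub>R b2 j) + 2 * V (\<lambda>j. - b2 j)" by (rule V_add)
    also have "V (\<lambda>j. - b2 j) = V b2" by (simp add: V_def sum_negf)
    also have "V (\<lambda>j. e n j *\<^sub>R b2 j) \<le> ennreal K * V b2"
      unfolding V_def K_def by (intro suminf_multiplier_le[where n=n] assms)
    also have "2 * (ennreal K * V b2) + 2 * V b2 = ennreal (2 * (K + 1)) * V b2"
      using K by (simp add: ennreal_mult' ennreal_plus algebra_simps)
    also have "\<dots> \<le> ennreal (2 * (K + 1)) * ennreal (r / (8 * (K + 1)))"
      using V2 by (intro mult_left_mono) auto
    also have "\<dots> = ennreal (r / 4)"
      using K r by (subst ennreal_mult'[symmetric]) (auto simp: divide_simps intro!: arg_cong[where f=ennreal])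
    finally have 2: "V (\<lambda>j. (e n j - 1) *\<^sub>R b2 j) \<le> ennreal (r / 4)"
      by (simp add: add_right_mono mult_left_mono)
    have "V (\<lambda>j. (e n j - 1) *\<^sub>R b j) = V (\<lambda>j. (e n j - 1) *\<^sub>R b1 j + (e n j - 1) *\<^sub>R b2 j)"
      by (simp add: b2_def algebra_simps)
    also have "\<dots> \<le> 2 * V (\<lambda>j. (e n j - 1) *\<^sub>R b1 j) + 2 * V (\<lambda>j. (e n j - 1) *\<^sub>R b2 j)" by (rule V_add)
    also have "\<dots> \<le> 2 * ennreal (r / 4) + 2 * ennreal (r / 4)"
      using elim 2 by (intro add_mono mult_left_mono) auto
    also have "2 * ennreal (r / 4) = ennreal (r / 2)"
      using r ennreal_mult[of 2 "r / 4"] by simp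
    also have "ennreal (r / 2) + ennreal (r / 2) = ennreal r"
      using r by (subst ennreal_plus[symmetric]) auto
    also have "\<dots> < a" by fact
    finally show ?case by (simp add: V_def)
  qed
qed simp

subsection \<open>Rotation invariance of Lebesgue measure\<close>

lemma nn_integral_translation:
  fixes N :: "'a::euclidean_space measure"
  assumes "sets N = sets borel" "\<And>c. distr N borel ((+) c) = N"
    and [measurable]: "g \<in> borel_measurable borel"
  shows "(\<integral>\<^sup>+ y. g (c + y) \<partial>N) = (\<integral>\<^sup>+ y. g y \<partial>N)"
proof -
  have "(\<integral>\<^sup>+ y. g y \<partial>N) = (\<integral>\<^sup>+ y. g y \<partial>distr N borel ((+) c))" by (simp add: assms)
  also have "\<dots> = (\<integral>\<^sup>+ y. g (c + y) \<partial>N)"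
    by (subst nn_integral_distr) (simp_all add: measurable_cong_sets[OF assms(1) refl])
  finally show ?thesis ..
qed

lemma nn_integral_lborel_reflect:
  fixes g :: "'a::euclidean_space \<Rightarrow> ennreal"
  assumes [measurable]: "g \<in> borel_measurable borel"
  shows "(\<integral>\<^sup>+ x. g (y - x) \<partial>lborel) = (\<integral>\<^sup>+ x. g x \<partial>lborel)"
proof -
  have "(\<integral>\<^sup>+ x. g x \<partial>lborel)
      = (\<integral>\<^sup>+ x. g x \<partial>density (distr lborel borel (\<lambda>x. y + (-1) *\<^sub>R x)) (\<lambda>_. \<bar>-1::real\<bar> ^ DIM('a)))"
    using lborel_affine[of "-1" y] by simp
  also have "\<dots> = (\<integral>\<^sup>+ x. g (y - x) \<partial>lborel)"
    by (simp add: nn_integral_density nn_integral_distr)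
  finally show ?thesis ..
qed

text \<open>Uniqueness of Haar measure: evaluate \<open>\<integral>\<integral> indicator B y * indicator (ball 0 1) x\<close>
  with respect to the two measures after the shears \<open>x \<mapsto> x + y\<close> and \<open>y \<mapsto> y - x\<close>.\<close>

lemma translation_invariant_eq_lborel:
  fixes N :: "'a::euclidean_space measure"
  assumes sets: "sets N = sets borel" and "sigma_finite_measure N"
    and inv: "\<And>c. distr N borel ((+) c) = N"
    and ball: "emeasure N (ball 0 1) = emeasure lborel (ball (0::'a) 1)"
  shows "N = lborel"
proof (rule measure_eqI)
  fix B assume "B \<in> sets N"
  then have [measurable]: "B \<in> sets borel" by (simp add: sets)
  interpret N: sigma_finite_measure N by fact
  interpret P: pair_sigma_finite lborel N ..
  note [measurable_cong] = sets
  define U where "U = ball (0::'a) 1"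
  have [measurable]: "U \<in> sets borel" by (simp add: U_def)
  let ?i = "\<lambda>A x. indicator A x :: ennreal"
  have "emeasure N B * emeasure lborel U = (\<integral>\<^sup>+ y. ?i B y * (\<integral>\<^sup>+ x. ?i U x \<partial>lborel) \<partial>N)"
    by (simp add: nn_integral_multc sets)
  also have "\<dots> = (\<integral>\<^sup>+ y. ?i B y * (\<integral>\<^sup>+ x. ?i U (y + x) \<partial>lborel) \<partial>N)"
    by (subst nn_integral_translation[where N=lborel and g="?i U"]) (simp_all add: lborel_distr_plus borel_measurable_indicator)
  also have "\<dots> = (\<integral>\<^sup>+ y. (\<integral>\<^sup>+ x. ?i B y * ?i U (y + x) \<partial>lborel) \<partial>N)"
    by (intro nn_integral_cong nn_integral_cmult[symmetric]) measurable
  also have "\<dots> = (\<integral>\<^sup>+ x. (\<integral>\<^sup>+ y. ?i B y * ?i U (y + x) \<partial>N) \<partial>lborel)"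
    by (rule P.Fubini') measurable
  also have "\<dots> = (\<integral>\<^sup>+ x. (\<integral>\<^sup>+ y. ?i B (- x + y) * ?i U (- x + y + x) \<partial>N) \<partial>lborel)"
    by (subst nn_integral_translation[OF sets inv, where g="\<lambda>y. ?i B y * ?i U (y + _)"]) simp_all
  also have "\<dots> = (\<integral>\<^sup>+ x. (\<integral>\<^sup>+ y. ?i B (y - x) * ?i U y \<partial>N) \<partial>lborel)"
    by simp
  also have "\<dots> = (\<integral>\<^sup>+ y. (\<integral>\<^sup>+ x. ?i B (y - x) * ?i U y \<partial>lborel) \<partial>N)"
    by (rule P.Fubini'[symmetric]) measurable
  also have "\<dots> = (\<integral>\<^sup>+ y. emeasure lborel B * ?i U y \<partial>N)"
    by (simp add: nn_integral_multc nn_integral_lborel_reflect[where g="?i B"])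
  also have "\<dots> = emeasure lborel B * emeasure lborel U"
    using ball by (simp add: nn_integral_cmult_indicator sets flip: U_def)
  finally have "emeasure lborel U * emeasure N B = emeasure lborel U * emeasure lborel B"
    by (simp add: mult_ac)
  moreover have "emeasure lborel U \<noteq> 0" "emeasure lborel U \<noteq> \<infinity>"
    by (simp_all add: U_def emeasure_ball less_imp_neq[symmetric])
  ultimately show "emeasure N B = emeasure lborel B"
    by (simp add: ennreal_mult_cancel_left)
qed (simp add: sets)

text \<open>The image measure is translation invariant because \<open>f\<close> is additive and
  onto, and it gives the unit ball the right mass because \<open>f\<close> maps balls about 0 onto
  themselves.\<close>

lemma lborel_distr_linear_isometry:
  fixes f :: "'a::euclidean_space \<Rightarrow> 'a"
  assumes lin: "linear f" and norm: "\<And>x. norm (f x) = norm x"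
  shows "distr lborel borel f = lborel"
proof (rule translation_invariant_eq_lborel)
  have [measurable]: "f \<in> borel_measurable borel"
    using linear_continuous_on[of f UNIV] lin
    by (simp add: linear_conv_bounded_linear borel_measurable_continuous_onI)
  have "inj f" using lin norm by (simp add: linear_injective_0) (metis norm_eq_zero)
  then have "surj f" using linear_injective_imp_surjective[OF lin] by simp
  have vim: "f -` ball 0 r = ball 0 r" for r using norm by auto
  then have em: "emeasure (distr lborel borel f) (ball 0 r) = emeasure lborel (ball (0::'a) r)" for r
    by (simp add: emeasure_distr)
  then show "emeasure (distr lborel borel f) (ball 0 1) = emeasure lborel (ball (0::'a) 1)" .
  show "sigma_finite_measure (distr lborel borel f)"
  proof
    show "\<exists>A. countable A \<and> A \<subseteq> sets (distr lborel borel f) \<and>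
        \<Union> A = space (distr lborel borel f) \<and> (\<forall>a\<in>A. emeasure (distr lborel borel f) a \<noteq> \<infinity>)"
      using reals_Archimedean2[of "norm (_ :: 'a)"]
      by (intro exI[of _ "range (\<lambda>n::nat. ball (0::'a) (real n))"])
        (auto simp: em emeasure_ball)
  qed
  fix c
  \<comment> \<open>Translation by \<open>c\<close> after \<open>f\<close> is \<open>f\<close> after
    translation by \<open>b\<close>, and the latter preserves \<open>lborel\<close>.\<close>
  obtain b where b: "c = f b" using \<open>surj f\<close> by blast
  have "distr (distr lborel borel f) borel ((+) c) = distr lborel borel (\<lambda>x. f (b + x))"
    by (subst distr_distr) (auto simp: o_def b linear_add[OF lin])
  also have "\<dots> = distr (distr lborel borel ((+) b)) borel f"
    by (subst distr_distr) (auto simp: o_def)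
  also have "\<dots> = distr lborel borel f" by (simp add: lborel_distr_plus)
  finally show "distr (distr lborel borel f) borel ((+) c) = distr lborel borel f" .
qed simp

subsection \<open>Parseval on the disc\<close>

lemma borel_measurable_cnj [measurable]: "cnj \<in> borel_measurable borel"
  by (intro borel_measurable_continuous_onI continuous_intros)

lemma sets_borel_ball [measurable]: "ball (c :: 'a::metric_space) r \<in> sets borel"
  by simp

abbreviation disc_measure :: "complex measure" where
  "disc_measure \<equiv> uniform_measure lborel (ball 0 1)"

lemma sets_disc_measure [measurable_cong]: "sets disc_measure = sets borel"
  by simp

lemma emeasure_ball_complex: "r \<ge> 0 \<Longrightarrow> emeasure lborel (ball (0::complex) r) = ennreal (pi * r\<^sup>2)"
  using emeasure_ball[of r "0::complex"] by (simp add: unit_ball_vol_2)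

lemma emeasure_disc_measure:
  "A \<in> sets borel \<Longrightarrow> emeasure disc_measure A = emeasure lborel (ball 0 1 \<inter> A) / ennreal pi"
  using emeasure_ball_complex[of 1] by simp

lemma finite_measure_disc: "finite_measure disc_measure"
  by (rule finite_measureI) (simp add: emeasure_disc_measure emeasure_ball_complex ennreal_divide_self)

lemma distr_disc_measure_rotation:
  assumes "cmod u = 1"
  shows "distr disc_measure borel (\<lambda>z. u * z) = disc_measure"
proof (rule measure_eqI)
  fix A assume "A \<in> sets (distr disc_measure borel (\<lambda>z. u * z))"
  then have [measurable]: "A \<in> sets borel" by simp
  have "(\<lambda>z. u * z) -` A \<in> sets borel"
    using measurable_sets[of "\<lambda>z. u * z" borel borel A] by simp
  then have "emeasure (distr disc_measure borel (\<lambda>z. u * z)) A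
      = emeasure lborel (ball 0 1 \<inter> (\<lambda>z. u * z) -` A) / ennreal pi"
    by (simp add: emeasure_distr emeasure_disc_measure del: emeasure_uniform_measure)
  also have "ball 0 1 \<inter> (\<lambda>z. u * z) -` A = (\<lambda>z. u * z) -` (ball 0 1 \<inter> A)"
    using assms by (auto simp: norm_mult)
  also have "emeasure lborel \<dots> = emeasure (distr lborel borel (\<lambda>z. u * z)) (ball 0 1 \<inter> A)"
    by (simp add: emeasure_distr)
  also have "distr lborel borel (\<lambda>z. u * z) = lborel"
    using assms by (intro lborel_distr_linear_isometry) (auto simp: norm_mult linear_times)
  finally show "emeasure (distr disc_measure borel (\<lambda>z. u * z)) A = emeasure disc_measure A"
    by (simp add: emeasure_disc_measure del: emeasure_uniform_measure)
qed simp

text \<open>Some rotation multiplies the integrand by -1 while preserving the measure, so the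
  integral equals its own negative.\<close>

lemma integral_disc_monomials_orthogonal:
  fixes \<psi> :: "complex \<Rightarrow> real"
  assumes [measurable]: "\<psi> \<in> borel_measurable borel"
    and rot: "\<And>u z. cmod u = 1 \<Longrightarrow> \<psi> (u * z) = \<psi> z" and "j \<noteq> k"
  shows "(\<integral>z. z ^ j * cnj z ^ k * of_real (\<psi> z) \<partial>disc_measure) = 0"
proof -
  let ?g = "\<lambda>z. z ^ j * cnj z ^ k * of_real (\<psi> z)"
  \<comment> \<open>Chosen so that \<open>(j - k) * t = pi\<close>, whence the rotation factor is
    \<open>cis pi\<close>.\<close>
  define t where "t = pi / (real j - real k)"
  define u where "u = cis t"
  have "u ^ j * cnj u ^ k = cis (real j * t - real k * t)"
    unfolding u_def cis_cnj Complex.DeMoivre cis_mult by simp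
  also have "real j * t - real k * t = pi"
    using \<open>j \<noteq> k\<close> by (subst left_diff_distrib[symmetric]) (simp add: t_def)
  finally have u: "u ^ j * cnj u ^ k = -1" by simp
  have "cmod u = 1" by (simp add: u_def)
  have "(\<integral>z. ?g z \<partial>disc_measure) = (\<integral>z. ?g z \<partial>distr disc_measure borel (\<lambda>z. u * z))"
    by (simp add: distr_disc_measure_rotation \<open>cmod u = 1\<close>)
  also have "\<dots> = (\<integral>z. ?g (u * z) \<partial>disc_measure)"
    by (rule integral_distr) simp_all
  also have "\<dots> = (\<integral>z. (u ^ j * cnj u ^ k) * ?g z \<partial>disc_measure)"
    by (intro Bochner_Integration.integral_cong)
      (simp, simp only: power_mult_distrib complex_cnj_mult rot[OF \<open>cmod u = 1\<close>], simp only: ac_simps)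
  also have "\<dots> = - (\<integral>z. ?g z \<partial>disc_measure)"
    unfolding u by simp
  finally show ?thesis by simp
qed

text \<open>Expanding the squared modulus gives a double sum in which orthogonality leaves only the
  diagonal. The bounds on \<open>\<psi>\<close> make every monomial term integrable over the finite
  measure.\<close>

lemma nn_integral_disc_polynomial:
  fixes \<psi> :: "complex \<Rightarrow> real" and a :: "nat \<Rightarrow> complex"
  assumes [measurable]: "\<psi> \<in> borel_measurable borel"
    and rot: "\<And>u z. cmod u = 1 \<Longrightarrow> \<psi> (u * z) = \<psi> z"
    and bnd: "\<And>z. 0 \<le> \<psi> z" "\<And>z. \<psi> z \<le> 1" "\<And>z. cmod z \<ge> 1 \<Longrightarrow> \<psi> z = 0"
  shows "(\<integral>\<^sup>+z. ennreal ((cmod (\<Sum>k<N. a k * z ^ k))\<^sup>2 * \<psi> z) \<partial>disc_measure)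
       = (\<Sum>k<N. \<integral>\<^sup>+z. ennreal ((cmod (a k) * cmod z ^ k)\<^sup>2 * \<psi> z) \<partial>disc_measure)"
proof -
  interpret finite_measure disc_measure by (rule finite_measure_disc)
  let ?e = "\<lambda>j k z. z ^ j * cnj z ^ k * complex_of_real (\<psi> z)"
  have int: "integrable disc_measure (?e j k)" for j k
  proof (rule integrable_const_bound[where B = 1])
    show "AE z in disc_measure. cmod (?e j k z) \<le> 1"
    proof (rule AE_I2)
      fix z
      show "cmod (?e j k z) \<le> 1"
      proof (cases "cmod z \<ge> 1")
        case False
        then show ?thesis using bnd(1,2)[of z]
          by (auto simp: norm_mult norm_power intro!: mult_le_one power_le_one)
      qed (simp add: bnd)
    qed
  qed measurable
  have dbl: "of_real ((cmod (\<Sum>k<N. a k * z ^ k))\<^sup>2 * \<psi> z)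
      = (\<Sum>j<N. \<Sum>k<N. a j * cnj (a k) * ?e j k z)" for z
    by (simp only: of_real_mult complex_norm_square cnj_sum complex_cnj_mult complex_cnj_power
        sum_product sum_distrib_right) (simp add: sum_distrib_left mult_ac)
  have "integrable disc_measure (\<lambda>z. complex_of_real ((cmod (\<Sum>k<N. a k * z ^ k))\<^sup>2 * \<psi> z))"
    unfolding dbl by (intro Bochner_Integration.integrable_sum integrable_mult_right int)
  then have int': "integrable disc_measure (\<lambda>z. (cmod (\<Sum>k<N. a k * z ^ k))\<^sup>2 * \<psi> z)"
    by (simp only: complex_of_real_integrable_eq)
  have diag: "?e k k z = of_real (cmod z ^ (2 * k) * \<psi> z)" for k z
    using complex_norm_square[of z] by (simp add: power_mult flip: power_mult_distrib)
  have intk: "integrable disc_measure (\<lambda>z. cmod z ^ (2 * k) * \<psi> z)" for k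
    using int[of k k] unfolding diag by (simp only: complex_of_real_integrable_eq)
  have "of_real (\<integral>z. (cmod (\<Sum>k<N. a k * z ^ k))\<^sup>2 * \<psi> z \<partial>disc_measure)
      = (\<integral>z. (\<Sum>j<N. \<Sum>k<N. a j * cnj (a k) * ?e j k z) \<partial>disc_measure)"
    unfolding dbl[symmetric] by (rule integral_complex_of_real[symmetric])
  also have "\<dots> = (\<Sum>j<N. \<Sum>k<N. a j * cnj (a k) * (\<integral>z. ?e j k z \<partial>disc_measure))"
    by (subst Bochner_Integration.integral_sum;
        (intro Bochner_Integration.integrable_sum integrable_mult_right int)?)
      (subst Bochner_Integration.integral_sum;
        (intro integrable_mult_right int sum.cong refl integral_mult_right_zero)?)
  also have "\<dots> = (\<Sum>j<N. \<Sum>k<N. if k = j then a j * cnj (a j) * (\<integral>z. ?e j j z \<partial>disc_measure) else 0)"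
    using integral_disc_monomials_orthogonal[OF assms(1) rot] by (intro sum.cong refl) auto
  also have "\<dots> = (\<Sum>j<N. a j * cnj (a j) * (\<integral>z. ?e j j z \<partial>disc_measure))"
    by simp
  also have "\<dots> = of_real (\<Sum>j<N. (cmod (a j))\<^sup>2 * (\<integral>z. cmod z ^ (2 * j) * \<psi> z \<partial>disc_measure))"
    unfolding diag integral_complex_of_real by (simp only: of_real_sum of_real_mult complex_norm_square)
  finally have eq: "(\<integral>z. (cmod (\<Sum>k<N. a k * z ^ k))\<^sup>2 * \<psi> z \<partial>disc_measure)
      = (\<Sum>j<N. (cmod (a j))\<^sup>2 * (\<integral>z. cmod z ^ (2 * j) * \<psi> z \<partial>disc_measure))"
    by (simp only: of_real_eq_iff)
  have "(\<integral>\<^sup>+z. ennreal ((cmod (\<Sum>k<N. a k * z ^ k))\<^sup>2 * \<psi> z) \<partial>disc_measure)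
      = ennreal (\<Sum>j<N. (cmod (a j))\<^sup>2 * (\<integral>z. cmod z ^ (2 * j) * \<psi> z \<partial>disc_measure))"
    unfolding eq[symmetric] using bnd(1) by (intro nn_integral_eq_integral int') auto
  also have "\<dots> = (\<Sum>j<N. ennreal (\<integral>z. (cmod (a j))\<^sup>2 * (cmod z ^ (2 * j) * \<psi> z) \<partial>disc_measure))"
    using bnd(1) by (subst sum_ennreal[symmetric]) (auto intro!: mult_nonneg_nonneg integral_nonneg_AE)
  also have "\<dots> = (\<Sum>j<N. \<integral>\<^sup>+z. ennreal ((cmod (a j))\<^sup>2 * (cmod z ^ (2 * j) * \<psi> z)) \<partial>disc_measure)"
    using bnd(1) by (intro sum.cong refl nn_integral_eq_integral[symmetric] integrable_mult_right intk) auto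
  finally show ?thesis unfolding power_even_eq by (simp add: power_mult_distrib mult_ac)
qed

text \<open>On a disc of radius \<open>r < 1\<close> the partial sums are uniformly bounded, so
  dominated convergence passes from polynomials to \<open>h\<close>. As \<open>h\<close> is
  arbitrary off the disc, measurability is obtained only for the product with \<open>\<psi>\<close>,
  as a pointwise limit.\<close>

lemma nn_integral_disc_parseval_truncated:
  fixes \<psi> :: "complex \<Rightarrow> real" and a :: "nat \<Rightarrow> complex"
  assumes [measurable]: "\<psi> \<in> borel_measurable borel"
    and rot: "\<And>u z. cmod u = 1 \<Longrightarrow> \<psi> (u * z) = \<psi> z"
    and bnd: "\<And>z. 0 \<le> \<psi> z" "\<And>z. \<psi> z \<le> 1" "\<And>z. cmod z \<ge> r \<Longrightarrow> \<psi> z = 0"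
    and r: "0 < r" "r < 1" and h: "\<And>z. cmod z < 1 \<Longrightarrow> (\<lambda>k. a k * z ^ k) sums h z"
  shows "(\<lambda>z. (cmod (h z))\<^sup>2 * \<psi> z) \<in> borel_measurable borel"
    and "(\<integral>\<^sup>+z. ennreal ((cmod (h z))\<^sup>2 * \<psi> z) \<partial>disc_measure)
       = (\<integral>\<^sup>+z. (\<Sum>k. ennreal ((cmod (a k) * cmod z ^ k)\<^sup>2 * \<psi> z)) \<partial>disc_measure)"
proof -
  let ?p = "\<lambda>N z. \<Sum>k<N. a k * z ^ k"
  have lim: "(\<lambda>N. (cmod (?p N z))\<^sup>2 * \<psi> z) \<longlonglongrightarrow> (cmod (h z))\<^sup>2 * \<psi> z" for z
  proof (cases "cmod z < r")
    case True
    then have "(\<lambda>N. ?p N z) \<longlonglongrightarrow> h z" using h[of z] r by (simp add: sums_def)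
    then show ?thesis by (intro tendsto_intros)
  qed (simp add: bnd)
  show "(\<lambda>z. (cmod (h z))\<^sup>2 * \<psi> z) \<in> borel_measurable borel"
    by (rule borel_measurable_LIMSEQ_real[OF lim]) measurable
  note [measurable] = this
  \<comment> \<open>Convergence at the larger radius \<open>(1 + r) / 2\<close> gives absolute
    convergence at \<open>r\<close>.\<close>
  have "summable (\<lambda>k. a k * of_real ((1 + r) / 2) ^ k)"
    using h[of "of_real ((1 + r) / 2)"] r by (simp add: sums_iff del: of_real_divide of_real_add)
  then have "summable (\<lambda>k. norm (a k * of_real r ^ k))"
    using r by (elim powser_insidea) (simp del: of_real_divide of_real_add)
  then have sm: "summable (\<lambda>k. cmod (a k) * r ^ k)" using r by (simp add: norm_mult norm_power)
  define K where "K = (\<Sum>k. cmod (a k) * r ^ k)"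
  have K: "(cmod (?p N z))\<^sup>2 * \<psi> z \<le> K\<^sup>2" for N z
  proof (cases "cmod z < r")
    case True
    have "cmod (?p N z) \<le> (\<Sum>k<N. cmod (a k) * r ^ k)"
      using True by (intro sum_norm_le) (auto simp: norm_mult norm_power intro!: mult_left_mono power_mono)
    also have "\<dots> \<le> K" unfolding K_def using sm r by (intro sum_le_suminf) auto
    finally have "(cmod (?p N z))\<^sup>2 \<le> K\<^sup>2" by (intro power_mono) auto
    then show ?thesis
      using mult_mono[of "(cmod (?p N z))\<^sup>2" "K\<^sup>2" "\<psi> z" 1] bnd(1,2)[of z] by simp
  qed (simp add: bnd)
  have "(\<lambda>N. \<integral>\<^sup>+z. ennreal ((cmod (?p N z))\<^sup>2 * \<psi> z) \<partial>disc_measure)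
      \<longlonglongrightarrow> (\<integral>\<^sup>+z. ennreal ((cmod (h z))\<^sup>2 * \<psi> z) \<partial>disc_measure)"
  proof (rule nn_integral_dominated_convergence[where w = "\<lambda>_. ennreal (K\<^sup>2)"])
    show "(\<integral>\<^sup>+z. ennreal (K\<^sup>2) \<partial>disc_measure) < \<infinity>"
      using emeasure_disc_measure[of UNIV] emeasure_ball_complex[of 1]
      by (simp add: ennreal_divide_self)
  qed (use K lim in \<open>auto intro!: ennreal_leI tendsto_ennrealI\<close>)
  moreover have "(\<integral>\<^sup>+z. ennreal ((cmod (?p N z))\<^sup>2 * \<psi> z) \<partial>disc_measure)
      = (\<Sum>k<N. \<integral>\<^sup>+z. ennreal ((cmod (a k) * cmod z ^ k)\<^sup>2 * \<psi> z) \<partial>disc_measure)" for N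
    using r bnd by (intro nn_integral_disc_polynomial rot) auto
  moreover have "(\<lambda>N. \<Sum>k<N. \<integral>\<^sup>+z. ennreal ((cmod (a k) * cmod z ^ k)\<^sup>2 * \<psi> z) \<partial>disc_measure)
      \<longlonglongrightarrow> (\<Sum>k. \<integral>\<^sup>+z. ennreal ((cmod (a k) * cmod z ^ k)\<^sup>2 * \<psi> z) \<partial>disc_measure)"
    by (intro summable_LIMSEQ) auto
  ultimately have "(\<integral>\<^sup>+z. ennreal ((cmod (h z))\<^sup>2 * \<psi> z) \<partial>disc_measure)
      = (\<Sum>k. \<integral>\<^sup>+z. ennreal ((cmod (a k) * cmod z ^ k)\<^sup>2 * \<psi> z) \<partial>disc_measure)"
    by (simp add: LIMSEQ_unique)
  also have "\<dots> = (\<integral>\<^sup>+z. (\<Sum>k. ennreal ((cmod (a k) * cmod z ^ k)\<^sup>2 * \<psi> z)) \<partial>disc_measure)"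
    by (intro nn_integral_suminf[symmetric]) simp
  finally show "(\<integral>\<^sup>+z. ennreal ((cmod (h z))\<^sup>2 * \<psi> z) \<partial>disc_measure)
       = (\<integral>\<^sup>+z. (\<Sum>k. ennreal ((cmod (a k) * cmod z ^ k)\<^sup>2 * \<psi> z)) \<partial>disc_measure)" .
qed

text \<open>Monotone convergence along concentric discs. Measurability is asked of the truncations,
  as that is what \<open>nn_integral_disc_parseval_truncated\<close> supplies.\<close>

lemma nn_integral_disc_exhaustion:
  fixes G :: "complex \<Rightarrow> ennreal"
  assumes "\<And>n. (\<lambda>z. G z * indicator (ball 0 (1 - 1 / real (Suc n))) z) \<in> borel_measurable borel"
  shows "(\<integral>\<^sup>+z\<in>ball 0 1. G z \<partial>disc_measure)
       = (SUP n. \<integral>\<^sup>+z\<in>ball 0 (1 - 1 / real (Suc n)). G z \<partial>disc_measure)"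
proof -
  let ?r = "\<lambda>n. 1 - 1 / real (Suc n)"
  have r: "mono ?r" by (intro monoI) (simp add: frac_le)
  have "(SUP n. G z * indicator (ball 0 (?r n)) z) = G z * indicator (ball 0 1) z" for z
  proof (cases "cmod z < 1")
    case True
    then obtain n where n: "inverse (real (Suc n)) < 1 - cmod z"
      using reals_Archimedean[of "1 - cmod z"] by auto
    then have "z \<in> ball 0 (?r n)" by (simp add: inverse_eq_divide)
    moreover have "indicator (ball 0 (?r i)) z \<le> (1::ennreal)" for i
      by (simp add: indicator_def)
    ultimately show ?thesis using True
      by (intro antisym SUP_least SUP_upper2[of n]) (auto simp: indicator_def)
  next
    case False
  moreover have "?r n < 1" for n by simp
    ultimately have "z \<notin> ball 0 (?r n)" for n
      by (metis less_trans mem_ball_0)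
    then show ?thesis using False by simp
  qed
  then have "(\<integral>\<^sup>+z\<in>ball 0 1. G z \<partial>disc_measure)
      = (\<integral>\<^sup>+z. (SUP n. G z * indicator (ball 0 (?r n)) z) \<partial>disc_measure)"
    by simp
  also have "\<dots> = (SUP n. \<integral>\<^sup>+z\<in>ball 0 (?r n). G z \<partial>disc_measure)"
  proof (rule nn_integral_monotone_convergence_SUP)
    show "incseq (\<lambda>n z. G z * indicator (ball 0 (?r n)) z)"
      using monoD[OF r] by (fastforce simp: incseq_def le_fun_def indicator_def)
  qed (use assms in simp)
  finally show ?thesis .
qed

section \<open>Radial integrals and the Beta function\<close>

text \<open>This takes the place of polar coordinates. For \<open>0 \<le> x < 1\<close> the annulus
  \<open>sqrt x < cmod z < 1\<close> has area \<open>(1 - x) * pi\<close>, so the two measures agree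
  on all open half-lines.\<close>

lemma distr_disc_measure_norm_squared:
  "distr disc_measure borel (\<lambda>z. (cmod z)\<^sup>2) = uniform_measure lborel {0..1}"
proof (rule measure_eqI_lessThan)
  fix x :: real
  have M: "emeasure (distr disc_measure borel (\<lambda>z. (cmod z)\<^sup>2)) {x<..}
      = emeasure lborel (ball 0 1 \<inter> {z::complex. x < (cmod z)\<^sup>2}) / ennreal pi" (is "_ = emeasure lborel ?A / _")
    by (simp add: emeasure_distr emeasure_disc_measure vimage_def del: emeasure_uniform_measure)
  have U: "emeasure (uniform_measure lborel {0..1}) {x<..} = emeasure lborel ({0..1} \<inter> {x<..})"
    by (simp add: divide_ennreal_def)
  consider "x < 0" | "0 \<le> x" "x < 1" | "x \<ge> 1" by linarith
  then show "emeasure (distr disc_measure borel (\<lambda>z. (cmod z)\<^sup>2)) {x<..}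
      = emeasure (uniform_measure lborel {0..1}) {x<..}"
  proof cases
    case 1
    then have "?A = ball 0 1" "{0..1} \<inter> {x<..} = {0..1}"
      by (auto intro: less_le_trans)
    with M U show ?thesis using emeasure_ball_complex[of 1] by (simp add: ennreal_divide_self)
  next
    case 2
    have iff: "x < (cmod z)\<^sup>2 \<longleftrightarrow> sqrt x < cmod z" for z
      using 2 by (metis real_sqrt_abs real_sqrt_less_iff abs_norm_cancel)
    have "sqrt x < 1" using 2 by simp
    have "emeasure lborel (ball (0::complex) 1 - cball 0 (sqrt x))
        = emeasure lborel (ball (0::complex) 1) - emeasure lborel (cball (0::complex) (sqrt x))"
      using 2 \<open>sqrt x < 1\<close> by (intro emeasure_Diff) (auto simp: emeasure_cball simp del: real_sqrt_lt_1_iff)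
    also have "\<dots> = ennreal pi - ennreal (pi * x)"
      using 2 by (simp add: emeasure_ball_complex emeasure_cball unit_ball_vol_2)
    also have "\<dots> = ennreal ((1 - x) * pi)"
      using 2 by (subst ennreal_minus) (auto simp: algebra_simps)
    also have "ball (0::complex) 1 - cball 0 (sqrt x) = ?A" unfolding iff by auto
    finally have "emeasure lborel ?A / ennreal pi = ennreal (1 - x)"
      using 2 by (simp add: divide_ennreal)
    moreover have "{0..1} \<inter> {x<..} = {x<..1}" using 2 by auto
    ultimately show ?thesis using M U 2 by simp
  next
    case 3
    have "\<not> x < (cmod z)\<^sup>2" if "cmod z < 1" for z
      using that 3 power_le_one[of "cmod z" 2] by simp
    then have "?A = {}" by auto
    moreover have "{0..1} \<inter> {x<..} = {}" using 3 by auto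
    ultimately show ?thesis using M U by simp
  qed
  show "emeasure (distr disc_measure borel (\<lambda>z. (cmod z)\<^sup>2)) {x<..} < \<infinity>"
    using finite_measure.emeasure_finite[OF finite_measure.finite_measure_distr[OF finite_measure_disc,
        of "\<lambda>z. (cmod z)\<^sup>2" borel], of "{x<..}"]
    by (simp add: less_top[symmetric] del: emeasure_uniform_measure)
qed simp_all

text \<open>The substitution \<open>s = (cmod z)^2\<close> turns the radial integral into Euler's
  Beta integral on the unit interval.\<close>

lemma nn_integral_disc_radial_Beta:
  "(\<integral>\<^sup>+z\<in>ball 0 1. ennreal ((cmod z ^ k)\<^sup>2 * (1 - (cmod z)\<^sup>2) ^ m) \<partial>disc_measure)
     = ennreal (Beta (real (Suc k)) (real (Suc m)))"
proof -
  have "AE z in disc_measure. z \<in> ball 0 1" by (rule AE_uniform_measureI) auto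
  then have "(\<integral>\<^sup>+z\<in>ball 0 1. ennreal ((cmod z ^ k)\<^sup>2 * (1 - (cmod z)\<^sup>2) ^ m) \<partial>disc_measure)
      = (\<integral>\<^sup>+z. ennreal (((cmod z)\<^sup>2) ^ k * (1 - (cmod z)\<^sup>2) ^ m) \<partial>disc_measure)"
    by (intro nn_integral_cong_AE) (auto simp: power_even_eq power_mult[symmetric] mult.commute)
  also have "\<dots> = (\<integral>\<^sup>+s. ennreal (s ^ k * (1 - s) ^ m) \<partial>distr disc_measure borel (\<lambda>z. (cmod z)\<^sup>2))"
    by (subst nn_integral_distr) auto
  also have "\<dots> = (\<integral>\<^sup>+s. ennreal (s ^ k * (1 - s) ^ m) * indicator {0..1} s \<partial>lborel)"
    unfolding distr_disc_measure_norm_squared by (subst nn_integral_uniform_measure) (auto simp: divide_ennreal_def)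
  \<comment> \<open>The endpoints are dropped because the Beta integral is stated with
    \<open>powr\<close>, and \<open>0 powr 0 = 0\<close> differs from
    \<open>0 ^ 0 = 1\<close>.\<close>
  also have "\<dots> = (\<integral>\<^sup>+s. ennreal (s ^ k * (1 - s) ^ m) * indicator {0<..<1} s \<partial>lborel)"
  proof (rule nn_integral_cong_AE)
    show "AE s in lborel. ennreal (s ^ k * (1 - s) ^ m) * indicator {0..1} s
        = ennreal (s ^ k * (1 - s) ^ m) * indicator {0<..<1} s"
      using AE_lborel_singleton[of 0] AE_lborel_singleton[of 1]
      by eventually_elim (auto simp: indicator_def)
  qed
  also have "\<dots> = ennreal (Beta (real (Suc k)) (real (Suc m)))"
  proof (rule nn_integral_has_integral_lebesgue')
    have "((\<lambda>t. t powr (real (Suc k) - 1) * (1 - t) powr (real (Suc m) - 1)) has_integral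
        Beta (real (Suc k)) (real (Suc m))) {0<..<1}"
      using has_integral_Beta_real[of "real (Suc k)" "real (Suc m)"] by (simp add: has_integral_Icc_iff_Ioo)
    then show "((\<lambda>t. t ^ k * (1 - t) ^ m) has_integral Beta (real (Suc k)) (real (Suc m))) {0<..<1}"
      by (rule has_integral_eq[rotated]) (auto simp: powr_realpow)
  qed auto
  finally show ?thesis .
qed

text \<open>The truncated identity on discs of radius below 1, followed by monotone convergence on
  both sides, so that infinite values are covered.\<close>

lemma nn_integral_disc_parseval:
  fixes a :: "nat \<Rightarrow> complex"
  assumes h: "\<And>z. cmod z < 1 \<Longrightarrow> (\<lambda>k. a k * z ^ k) sums h z"
  shows "(\<integral>\<^sup>+z\<in>ball 0 1. ennreal ((cmod (h z))\<^sup>2 * (1 - (cmod z)\<^sup>2) ^ m) \<partial>disc_measure)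
       = (\<Sum>k. ennreal (Beta (real (Suc k)) (real (Suc m)) * (cmod (a k))\<^sup>2))"
proof -
  let ?\<phi> = "\<lambda>z. (1 - (cmod z)\<^sup>2) ^ m"
  define r where "r = (\<lambda>n. 1 - 1 / real (Suc n))"
  define \<psi> where "\<psi> = (\<lambda>n z. indicator (ball 0 (r n)) z * ?\<phi> z)"
  define F where "F = (\<lambda>z. \<Sum>k. ennreal ((cmod (a k) * cmod z ^ k)\<^sup>2 * ?\<phi> z))"
  have [measurable]: "\<psi> n \<in> borel_measurable borel" for n
    unfolding \<psi>_def by measurable
  have [measurable]: "F \<in> borel_measurable borel"
    unfolding F_def by measurable
  have lt1: "(cmod z)\<^sup>2 \<le> 1" if "cmod z < 1" for z
    using that by (simp add: power_le_one)
  have r1: "r n < 1" for n by (simp add: r_def)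
  have \<psi>: "0 \<le> \<psi> n z" "\<psi> n z \<le> 1" "cmod z \<ge> r n \<Longrightarrow> \<psi> n z = 0" 
    "cmod u = 1 \<Longrightarrow> \<psi> n (u * z) = \<psi> n z" for n z u
    using lt1[of z] r1[of n] by (auto simp: \<psi>_def indicator_def norm_mult intro!: power_le_one)
  have h_eq: "ennreal ((cmod (h z))\<^sup>2 * ?\<phi> z) * indicator (ball 0 (r n)) z = ennreal ((cmod (h z))\<^sup>2 * \<psi> n z)" for n z
    by (simp add: \<psi>_def indicator_def)
  have F_eq: "F z * indicator (ball 0 (r n)) z = (\<Sum>k. ennreal ((cmod (a k) * cmod z ^ k)\<^sup>2 * \<psi> n z))" for n z
    by (simp add: F_def \<psi>_def indicator_def)
  have trunc: "(\<lambda>z. ennreal ((cmod (h z))\<^sup>2 * \<psi> n z)) \<in> borel_measurable borel"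
    "(\<integral>\<^sup>+z. ennreal ((cmod (h z))\<^sup>2 * \<psi> n z) \<partial>disc_measure)
       = (\<integral>\<^sup>+z. (\<Sum>k. ennreal ((cmod (a k) * cmod z ^ k)\<^sup>2 * \<psi> n z)) \<partial>disc_measure)" for n
  proof -
    \<comment> \<open>The truncated identity asks for a positive radius, whereas
      \<open>r 0 = 0\<close>.\<close>
    let ?s = "max (r n) (1 / 2)"
    have s: "\<psi> n z = 0" if "cmod z \<ge> ?s" for z using that \<psi>(3)[of n z] by simp
    show "(\<lambda>z. ennreal ((cmod (h z))\<^sup>2 * \<psi> n z)) \<in> borel_measurable borel"
      using r1[of n]
      by (intro measurable_compose[OF _ measurable_ennreal]
          nn_integral_disc_parseval_truncated(1)[where r="?s", OF _ \<psi>(4,1,2) s _ _ h]) auto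
    show "(\<integral>\<^sup>+z. ennreal ((cmod (h z))\<^sup>2 * \<psi> n z) \<partial>disc_measure)
       = (\<integral>\<^sup>+z. (\<Sum>k. ennreal ((cmod (a k) * cmod z ^ k)\<^sup>2 * \<psi> n z)) \<partial>disc_measure)"
      using r1[of n]
      by (intro nn_integral_disc_parseval_truncated(2)[where r="?s", OF _ \<psi>(4,1,2) s _ _ h]) auto
  qed
  have "(\<integral>\<^sup>+z\<in>ball 0 1. ennreal ((cmod (h z))\<^sup>2 * ?\<phi> z) \<partial>disc_measure)
      = (SUP n. \<integral>\<^sup>+z\<in>ball 0 (r n). ennreal ((cmod (h z))\<^sup>2 * ?\<phi> z) \<partial>disc_measure)"
    unfolding r_def
    by (intro nn_integral_disc_exhaustion) (simp only: h_eq[unfolded r_def] trunc(1))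
  also have "\<dots> = (SUP n. \<integral>\<^sup>+z\<in>ball 0 (r n). F z \<partial>disc_measure)"
    unfolding h_eq F_eq trunc(2) ..
  also have "\<dots> = (\<integral>\<^sup>+z\<in>ball 0 1. F z \<partial>disc_measure)"
    unfolding r_def by (intro nn_integral_disc_exhaustion[symmetric]) measurable
  also have "\<dots> = (\<integral>\<^sup>+z. (\<Sum>k. ennreal ((cmod (a k))\<^sup>2) *
      (ennreal ((cmod z ^ k)\<^sup>2 * ?\<phi> z) * indicator (ball 0 1) z)) \<partial>disc_measure)"
    unfolding F_def
    by (intro nn_integral_cong)
      (auto simp: indicator_def ennreal_mult' power_mult_distrib mult.assoc)
  also have "\<dots> = (\<Sum>k. \<integral>\<^sup>+z. ennreal ((cmod (a k))\<^sup>2) *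
      (ennreal ((cmod z ^ k)\<^sup>2 * ?\<phi> z) * indicator (ball 0 1) z) \<partial>disc_measure)"
    by (intro nn_integral_suminf) measurable
  also have "\<dots> = (\<Sum>k. ennreal ((cmod (a k))\<^sup>2) * ennreal (Beta (real (Suc k)) (real (Suc m))))"
  proof (intro arg_cong[where f=suminf] ext)
    fix k
    have "(\<integral>\<^sup>+z. ennreal ((cmod (a k))\<^sup>2) *
      (ennreal ((cmod z ^ k)\<^sup>2 * ?\<phi> z) * indicator (ball 0 1) z) \<partial>disc_measure) =
      ennreal ((cmod (a k))\<^sup>2) *
      (\<integral>\<^sup>+z\<in>ball 0 1. ennreal ((cmod z ^ k)\<^sup>2 * ?\<phi> z) \<partial>disc_measure)"
      by (intro nn_integral_cmult) measurable
    then show "(\<integral>\<^sup>+z. ennreal ((cmod (a k))\<^sup>2) *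
      (ennreal ((cmod z ^ k)\<^sup>2 * ?\<phi> z) * indicator (ball 0 1) z) \<partial>disc_measure) =
      ennreal ((cmod (a k))\<^sup>2) * ennreal (Beta (real (Suc k)) (real (Suc m)))"
      by (simp only: nn_integral_disc_radial_Beta)
  qed
  also have "\<dots> = (\<Sum>k. ennreal (Beta (real (Suc k)) (real (Suc m)) * (cmod (a k))\<^sup>2))"
    by (simp only: ennreal_mult''[OF zero_le_power2] mult.commute)
  finally show ?thesis .
qed

subsection \<open>Dirichlet-type integrals as integrals of local ones\<close>

lemma
  fixes m k :: nat
  assumes "m \<ge> 1"
  shows Beta_Suc_Suc_pos: "Beta (real (Suc k)) (real (Suc m)) > 0"
    and Beta_Suc_Suc_antimono: "Beta (real (Suc (Suc k))) (real (Suc m)) \<le> Beta (real (Suc k)) (real (Suc m))"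
    and Beta_Suc_Suc_telescope:
      "Beta (real (Suc k)) (real (Suc m)) = Beta (real (Suc k)) (real m) - Beta (real (Suc (Suc k))) (real m)"
    and Beta_Suc_right: "Beta (real (Suc k)) (real m) \<le> 2 * real (Suc k) * Beta (real (Suc k)) (real (Suc m))"
proof -
  have notin: "real (Suc i) \<notin> \<int>\<^sub>\<le>\<^sub>0" "real m \<notin> \<int>\<^sub>\<le>\<^sub>0" for i
    using assms by (auto elim!: nonpos_Ints_cases simp del: of_nat_Suc)
  show pos: "Beta (real (Suc k)) (real (Suc m)) > 0"
    by (simp add: Beta_def Gamma_real_pos del: of_nat_Suc)
  let ?w = "Beta (real (Suc k)) (real (Suc m))"
  have "(real (Suc k) + real (Suc m)) * Beta (real (Suc (Suc k))) (real (Suc m)) = real (Suc k) * ?w"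
    using Beta_plus1_left[OF notin(1), of k "real (Suc m)"] by (simp add: add_ac)
  also have "\<dots> \<le> (real (Suc k) + real (Suc m)) * ?w"
    using pos by (intro mult_right_mono) auto
  finally show "Beta (real (Suc (Suc k))) (real (Suc m)) \<le> ?w"
    by (rule mult_left_le_imp_le) simp
  show "?w = Beta (real (Suc k)) (real m) - Beta (real (Suc (Suc k))) (real m)"
    using Beta_plus1_plus1[OF notin(1) notin(2), of k] by (simp add: add_ac)
  have "real m * Beta (real (Suc k)) (real m) = (real (Suc k) + real m) * ?w"
    using Beta_plus1_right[OF notin(2), of "real (Suc k)"] by (simp add: add_ac)
  \<comment> \<open>The right side minus the left is \<open>(m - 1) * (k + 1) + m * k\<close>,
    nonnegative as \<open>m \<ge> 1\<close>.\<close>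
  also have "real (Suc k) + real m \<le> real m * (2 * real (Suc k))"
  proof -
    have "0 \<le> (real m - 1) * real k" using assms by simp
    then show ?thesis using assms by (simp add: algebra_simps)
  qed
  finally have "real m * Beta (real (Suc k)) (real m) \<le> real m * (2 * real (Suc k) * ?w)"
    using pos by (simp add: mult_right_mono mult.assoc)
  then show "Beta (real (Suc k)) (real m) \<le> 2 * real (Suc k) * ?w"
    using assms by simp
qed

text \<open>The sum telescopes to at most \<open>Beta (Suc n) m\<close>, and returning to the second
  argument \<open>Suc m\<close> costs the factor \<open>2 * Suc n\<close>. This provides the tail
  hypothesis of the multiplier lemmas with \<open>B = 2\<close>, and summability from
  \<open>n = 0\<close>.\<close>

lemma sum_Beta_Suc_Suc_tail_le:
  assumes "m \<ge> 1"
  shows "(\<Sum>k\<in>{n..<N}. Beta (real (Suc k)) (real (Suc m)))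
           \<le> 2 * real (Suc n) * Beta (real (Suc n)) (real (Suc m))"
proof -
  let ?v = "\<lambda>k. Beta (real (Suc k)) (real m)"
  have v: "?v k \<ge> 0" for k
    using assms by (simp add: Beta_def Gamma_real_pos less_imp_le del: of_nat_Suc)
  have "(\<Sum>k\<in>{n..<N}. Beta (real (Suc k)) (real (Suc m))) = (\<Sum>k\<in>{n..<N}. ?v k - ?v (Suc k))"
    by (intro sum.cong refl Beta_Suc_Suc_telescope assms)
  also have "\<dots> \<le> ?v n"
  proof (cases "n \<le> N")
    case True
    then have "(\<Sum>k\<in>{n..<N}. ?v k - ?v (Suc k)) = ?v n - ?v N"
      using sum_Suc_diff'[of n N "\<lambda>k. - ?v k"] by simp
    then show ?thesis using v[of N] by simp
  qed (use v[of n] in simp)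
  also have "\<dots> \<le> 2 * real (Suc n) * Beta (real (Suc n)) (real (Suc m))"
    by (rule Beta_Suc_right[OF assms])
  finally show ?thesis .
qed

lemma summable_Beta_Suc_Suc: "m \<ge> 1 \<Longrightarrow> summable (\<lambda>k. Beta (real (Suc k)) (real (Suc m)))"
  using sum_Beta_Suc_Suc_tail_le[of m 0] Beta_Suc_Suc_pos[of m]
  by (intro summableI_nonneg_bounded) (auto simp: less_imp_le atLeast0LessThan)

section \<open>The Poisson kernel in terms of Taylor coefficients\<close>

text \<open>Cauchy product of the Taylor series with the geometric series of ratio
  \<open>cnj \<zeta> * z\<close>.\<close>

lemma taylor_sums_divide_sphere:
  assumes F: "F holomorphic_on ball 0 1" and "cmod \<zeta> = 1" "cmod z < 1"
  shows "(\<lambda>k. (\<Sum>j\<le>k. (deriv ^^ j) F 0 / fact j * cnj \<zeta> ^ (k - j)) * z ^ k) sums (F z / (1 - cnj \<zeta> * z))"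
proof -
  let ?b = "\<lambda>j. (deriv ^^ j) F 0 / fact j"
  have pw: "(\<lambda>j. ?b j * w ^ j) sums F w" if "cmod w < 1" for w
    using holomorphic_power_series[OF F, of w] that by simp
  \<comment> \<open>A radius strictly between \<open>cmod z\<close> and 1, at which convergence
    gives absolute convergence at \<open>z\<close>.\<close>
  define s where "s = (1 + cmod z) / 2"
  have s: "cmod z < s" "s < 1" "s \<ge> 0" using assms(3) by (simp_all add: s_def add_nonneg_nonneg)
  have "summable (\<lambda>j. ?b j * of_real s ^ j)"
    using pw[of "of_real s"] s by (simp add: sums_iff)
  then have sm1: "summable (\<lambda>j. norm (?b j * z ^ j))"
    using s by (elim powser_insidea) simp
  have n: "cmod (cnj \<zeta> * z) < 1" using assms by (simp add: norm_mult)
  then have sm2: "summable (\<lambda>j. norm ((cnj \<zeta> * z) ^ j))"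
    by (simp add: norm_power summable_geometric)
  have "(\<lambda>k. \<Sum>j\<le>k. (?b j * z ^ j) * (cnj \<zeta> * z) ^ (k - j)) sums
      ((\<Sum>j. ?b j * z ^ j) * (\<Sum>j. (cnj \<zeta> * z) ^ j))"
    by (rule Cauchy_product_sums[OF sm1 sm2])
  moreover have "(\<Sum>j\<le>k. (?b j * z ^ j) * (cnj \<zeta> * z) ^ (k - j)) = (\<Sum>j\<le>k. ?b j * cnj \<zeta> ^ (k - j)) * z ^ k" for k
    unfolding sum_distrib_right
  proof (rule sum.cong)
    fix j assume "j \<in> {..k}"
    then have "z ^ k = z ^ j * z ^ (k - j)" by (simp flip: power_add)
    then show "(?b j * z ^ j) * (cnj \<zeta> * z) ^ (k - j) = ?b j * cnj \<zeta> ^ (k - j) * z ^ k"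
      by (simp add: power_mult_distrib)
  qed simp
  ultimately show ?thesis
    using pw[OF assms(3)] suminf_geometric[OF n] by (simp add: sums_iff divide_inverse)
qed

text \<open>Multiplication by the unimodular \<open>\<zeta> ^ k\<close> turns the left sum into the
  right one, as \<open>cnj \<zeta>\<close> is the inverse of \<open>\<zeta>\<close>.\<close>

lemma cmod_sum_cnj_power_sphere:
  assumes "cmod \<zeta> = 1"
  shows "cmod (\<Sum>j\<le>k. b j * cnj \<zeta> ^ (k - j)) = cmod (\<Sum>j\<le>k. b j * \<zeta> ^ j)"
proof -
  have "\<zeta> * cnj \<zeta> = 1" using assms complex_norm_square[of \<zeta>] by simp
  have "\<zeta> ^ k * cnj \<zeta> ^ (k - j) = \<zeta> ^ j" if "j \<le> k" for j
  proof -
    have "\<zeta> ^ k = \<zeta> ^ j * \<zeta> ^ (k - j)" using that by (simp flip: power_add)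
    then have "\<zeta> ^ k * cnj \<zeta> ^ (k - j) = \<zeta> ^ j * (\<zeta> * cnj \<zeta>) ^ (k - j)"
      by (simp only: power_mult_distrib mult.assoc)
    then show ?thesis by (simp only: \<open>\<zeta> * cnj \<zeta> = 1\<close> power_one mult_1_right)
  qed
  then have "\<zeta> ^ k * (\<Sum>j\<le>k. b j * cnj \<zeta> ^ (k - j)) = (\<Sum>j\<le>k. b j * \<zeta> ^ j)"
    unfolding sum_distrib_left by (intro sum.cong refl) (simp add: mult.left_commute)
  then have "cmod (\<zeta> ^ k) * cmod (\<Sum>j\<le>k. b j * cnj \<zeta> ^ (k - j)) = cmod (\<Sum>j\<le>k. b j * \<zeta> ^ j)"
    by (simp flip: norm_mult)
  then show ?thesis using assms by (simp add: norm_power)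
qed

text \<open>For unimodular \<open>\<zeta>\<close> the modulus of \<open>z - \<zeta>\<close> is that
  of \<open>1 - cnj \<zeta> * z\<close>, so the kernel's denominator is absorbed into a holomorphic
  quotient, to which Parseval applies.\<close>

lemma nn_integral_disc_poisson:
  assumes F: "F holomorphic_on ball 0 1" and \<zeta>: "cmod \<zeta> = 1"
  shows "(\<integral>\<^sup>+z\<in>ball 0 1. ennreal ((cmod (F z))\<^sup>2 * (1 - (cmod z)\<^sup>2) ^ m / (cmod (z - \<zeta>))\<^sup>2) \<partial>disc_measure)
       = (\<Sum>k. ennreal (Beta (real (Suc k)) (real (Suc m)) *
            (cmod (\<Sum>j\<le>k. (deriv ^^ j) F 0 / fact j * \<zeta> ^ j))\<^sup>2))"
proof -
  have "cnj \<zeta> * \<zeta> = 1" using assms complex_norm_square[of \<zeta>] by (simp add: mult.commute)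
  then have "1 - cnj \<zeta> * z = cnj \<zeta> * (\<zeta> - z)" for z by (simp add: right_diff_distrib)
  then have "cmod (1 - cnj \<zeta> * z) = cmod (z - \<zeta>)" for z
    using \<zeta> by (simp add: norm_mult norm_minus_commute)
  then have eq: "(cmod (F z))\<^sup>2 * (1 - (cmod z)\<^sup>2) ^ m / (cmod (z - \<zeta>))\<^sup>2
      = (cmod (F z / (1 - cnj \<zeta> * z)))\<^sup>2 * (1 - (cmod z)\<^sup>2) ^ m" for z
    by (simp add: norm_divide power_divide)
  show ?thesis
    unfolding eq
    by (subst nn_integral_disc_parseval[OF taylor_sums_divide_sphere[OF F \<zeta>]], assumption)
      (simp only: cmod_sum_cnj_power_sphere[OF \<zeta>])
qed

text \<open>Up to the factorial constant, this is the Dirichlet-type integral for a unit point mass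
  at \<open>\<zeta>\<close>. It takes a coefficient sequence instead of a function so that Cesaro
  means act on it as multipliers.\<close>

definition local_dirichlet :: "nat \<Rightarrow> (nat \<Rightarrow> complex) \<Rightarrow> complex \<Rightarrow> ennreal" where
  "local_dirichlet m b \<zeta> =
     (\<Sum>k. ennreal (Beta (real (Suc k)) (real (Suc m)) * (cmod (\<Sum>j\<le>k. b j * \<zeta> ^ j))\<^sup>2))"

text \<open>The Taylor coefficients of the \<open>m\<close>-th derivative at 0, hence
  \<open>fact j\<close> and not \<open>fact (j + m)\<close>.\<close>

definition deriv_coeff :: "nat \<Rightarrow> (complex \<Rightarrow> complex) \<Rightarrow> nat \<Rightarrow> complex" where
  "deriv_coeff m f j = (deriv ^^ (j + m)) f 0 / fact j"

lemma circle_measuresD: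
  assumes "\<mu> \<in> circle_measures"
  shows "finite_measure \<mu>" "\<zeta> \<in> space \<mu> \<Longrightarrow> cmod \<zeta> = 1" "(\<lambda>\<zeta>. \<zeta>) \<in> borel_measurable \<mu>"
proof -
  have sets: "sets \<mu> = sets (restrict_space borel (sphere 0 1))" and "finite_measure \<mu>"
    using assms by (auto simp: circle_measures_def)
  then show "finite_measure \<mu>" by simp
  show "cmod \<zeta> = 1" if "\<zeta> \<in> space \<mu>"
    using that sets_eq_imp_space_eq[OF sets] by (simp add: space_restrict_space)
  show "(\<lambda>\<zeta>. \<zeta>) \<in> borel_measurable \<mu>"
    unfolding measurable_cong_sets[OF sets refl]
    by (intro measurable_restrict_space1) simp
qed

lemma borel_measurable_local_dirichlet:
  assumes "\<mu> \<in> circle_measures"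
  shows "local_dirichlet m b \<in> borel_measurable \<mu>"
proof -
  note [measurable] = circle_measuresD(3)[OF assms]
  show ?thesis unfolding local_dirichlet_def by measurable
qed

text \<open>Tonelli exchanges the two integrals, and \<open>nn_integral_disc_poisson\<close>
  evaluates the inner one. The numerator of the Poisson kernel raises the exponent of the weight
  from \<open>m - 1\<close> to \<open>m\<close>.\<close>

lemma dirichlet_integral_eq_local:
  assumes \<mu>: "\<mu> \<in> circle_measures" and m: "m \<ge> 1" and f: "f holomorphic_on ball 0 1"
  shows "dirichlet_integral \<mu> m f = ennreal (1 / (fact m * fact (m - 1))) *
           (\<integral>\<^sup>+\<zeta>. local_dirichlet m (deriv_coeff m f) \<zeta> \<partial>\<mu>)"
proof -
  interpret \<mu>: finite_measure \<mu> by (rule circle_measuresD[OF \<mu>])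
  interpret D: finite_measure disc_measure by (rule finite_measure_disc)
  interpret P: pair_sigma_finite disc_measure \<mu> ..
  note [measurable] = circle_measuresD(3)[OF \<mu>]
  define F where "F = (deriv ^^ m) f"
  have F: "F holomorphic_on ball 0 1" unfolding F_def by (intro holomorphic_higher_deriv f open_ball)
  \<comment> \<open>Off the disc \<open>F\<close> is arbitrary, so measurability of \<open>G\<close>
    goes through this extension by zero.\<close>
  have [measurable]: "(\<lambda>z. indicator (ball 0 1) z *\<^sub>R F z) \<in> borel_measurable borel"
    by (intro borel_measurable_continuous_on_indicator holomorphic_on_imp_continuous_on F) simp
  define G where "G = (\<lambda>z \<zeta>. ennreal ((cmod (F z))\<^sup>2 * (1 - (cmod z)\<^sup>2) ^ m / (cmod (z - \<zeta>))\<^sup>2)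
      * indicator (ball 0 1) z)"
  have G_eq: "G z \<zeta> = ennreal ((cmod (indicator (ball 0 1) z *\<^sub>R F z))\<^sup>2 * (1 - (cmod z)\<^sup>2) ^ m / (cmod (z - \<zeta>))\<^sup>2)" for z \<zeta>
    by (simp add: G_def indicator_def)
  have [measurable]: "case_prod G \<in> borel_measurable (disc_measure \<Otimes>\<^sub>M \<mu>)"
    unfolding G_eq by measurable
  have "ennreal ((cmod (F z))\<^sup>2) * poisson_integral \<mu> z * ennreal ((1 - (cmod z)\<^sup>2) ^ (m - 1)) * indicator (ball 0 1) z
      = (\<integral>\<^sup>+\<zeta>. G z \<zeta> \<partial>\<mu>)" for z
  proof (cases "z \<in> ball 0 1")
    case True
    then have z: "0 \<le> 1 - (cmod z)\<^sup>2" by (simp add: power_le_one)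
    have pw: "(1 - (cmod z)\<^sup>2) ^ m = (1 - (cmod z)\<^sup>2) * (1 - (cmod z)\<^sup>2) ^ (m - 1)"
      using m by (metis Suc_diff_1 less_eq_Suc_le One_nat_def power_Suc)
    let ?c = "(cmod (F z))\<^sup>2 * (1 - (cmod z)\<^sup>2) ^ (m - 1)"
    have "(\<integral>\<^sup>+\<zeta>. G z \<zeta> \<partial>\<mu>) = (\<integral>\<^sup>+\<zeta>. ennreal ?c * ennreal ((1 - (cmod z)\<^sup>2) / (cmod (z - \<zeta>))\<^sup>2) \<partial>\<mu>)"
    proof (rule nn_integral_cong)
      fix \<zeta>
      have "G z \<zeta> = ennreal (?c * ((1 - (cmod z)\<^sup>2) / (cmod (z - \<zeta>))\<^sup>2))"
        using True by (simp add: G_def pw mult_ac)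
      also have "\<dots> = ennreal ?c * ennreal ((1 - (cmod z)\<^sup>2) / (cmod (z - \<zeta>))\<^sup>2)"
        using z by (intro ennreal_mult) auto
      finally show "G z \<zeta> = ennreal ?c * ennreal ((1 - (cmod z)\<^sup>2) / (cmod (z - \<zeta>))\<^sup>2)" .
    qed
    also have "\<dots> = ennreal ?c * poisson_integral \<mu> z"
      unfolding poisson_integral_def by (intro nn_integral_cmult) measurable
    finally show ?thesis using True z by (simp add: ennreal_mult mult_ac)
  qed (simp add: G_def)
  then have "dirichlet_integral \<mu> m f
      = ennreal (1 / (fact m * fact (m - 1))) * (\<integral>\<^sup>+z. \<integral>\<^sup>+\<zeta>. G z \<zeta> \<partial>\<mu> \<partial>disc_measure)"
    by (simp add: dirichlet_integral_def F_def)
  also have "(\<integral>\<^sup>+z. \<integral>\<^sup>+\<zeta>. G z \<zeta> \<partial>\<mu> \<partial>disc_measure) = (\<integral>\<^sup>+\<zeta>. \<integral>\<^sup>+z. G z \<zeta> \<partial>disc_measure \<partial>\<mu>)"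
    by (rule P.Fubini'[symmetric]) measurable
  also have "\<dots> = (\<integral>\<^sup>+\<zeta>. local_dirichlet m (deriv_coeff m f) \<zeta> \<partial>\<mu>)"
  proof (rule nn_integral_cong)
    fix \<zeta> assume "\<zeta> \<in> space \<mu>"
    then have "cmod \<zeta> = 1" by (rule circle_measuresD[OF \<mu>])
    then show "(\<integral>\<^sup>+z. G z \<zeta> \<partial>disc_measure) = local_dirichlet m (deriv_coeff m f) \<zeta>"
      unfolding G_def local_dirichlet_def deriv_coeff_def
      by (subst nn_integral_disc_poisson[OF F]) (simp_all add: F_def funpow_add)
  qed
  finally show ?thesis .
qed

section \<open>Cesaro means as multipliers of local integrals\<close>

text \<open>The mean is a polynomial, so its derivatives at 0 are read off from its coefficients.
  Differentiating \<open>m\<close> times moves the weight index from \<open>j\<close> to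
  \<open>j + m\<close>.\<close>

lemma deriv_coeff_cesaro_mean:
  "deriv_coeff m (cesaro_mean \<alpha> n f) = (\<lambda>j. cesaro_weight \<alpha> n (j + m) *\<^sub>R deriv_coeff m f j)"
proof
  fix j
  let ?k = "j + m"
  let ?a = "\<lambda>i. of_real (cesaro_binomial \<alpha> (n - i)) * fps_nth (fps_expansion f 0) i"
  define F where "F = fps_const (inverse (of_real (cesaro_binomial \<alpha> n))) *
    (\<Sum>i\<le>n. fps_const (?a i) * fps_X ^ i)"
  have "cesaro_mean \<alpha> n f has_fps_expansion F"
    unfolding cesaro_mean_def[abs_def] F_def
    by (intro has_fps_expansion_mult has_fps_expansion_sum has_fps_expansion_const has_fps_expansion_fps_X_power)
  then have "(deriv ^^ ?k) (cesaro_mean \<alpha> n f) 0 / fact ?k = fps_nth F ?k"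
    by (rule fps_nth_fps_expansion[symmetric])
  \<comment> \<open>No index matches when \<open>j + m > n\<close>; this agrees with the zero branch
    of \<open>cesaro_weight\<close>.\<close>
  also have "\<dots> = inverse (of_real (cesaro_binomial \<alpha> n)) * (\<Sum>i\<le>n. if i = ?k then ?a i else 0)"
    unfolding F_def fps_mult_left_const_nth fps_sum_nth fps_X_power_nth
    by (intro arg_cong2[where f = "(*)"] refl sum.cong) auto
  also have "\<dots> = of_real (cesaro_weight \<alpha> n ?k) * ((deriv ^^ ?k) f 0 / fact ?k)"
    by (simp add: cesaro_weight_def fps_expansion_def divide_inverse)
  finally show "deriv_coeff m (cesaro_mean \<alpha> n f) j = cesaro_weight \<alpha> n (j + m) *\<^sub>R deriv_coeff m f j"
    by (simp add: deriv_coeff_def scaleR_conv_of_real)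
qed

lemma cesaro_mean_holomorphic: "cesaro_mean \<alpha> n f holomorphic_on A"
  unfolding cesaro_mean_def[abs_def] by (intro holomorphic_intros)

lemma deriv_coeff_diff:
  assumes "f holomorphic_on ball 0 1" "g holomorphic_on ball 0 1"
  shows "deriv_coeff m (\<lambda>z. f z - g z) j = deriv_coeff m f j - deriv_coeff m g j"
  using higher_deriv_diff[OF assms open_ball, of 0 "j + m"]
  by (simp add: deriv_coeff_def diff_divide_distrib)

text \<open>The shifted terms are among the unshifted ones, and differences beyond \<open>n\<close>
  vanish, so the shift by \<open>m\<close> does not increase the bound.\<close>

lemma sum_shifted_cesaro_weight_diff_squares_le:
  assumes "\<alpha> > 1 / 2"
  shows "(\<Sum>k\<le>n. (cesaro_weight \<alpha> n (k + m) - cesaro_weight \<alpha> n (Suc k + m))\<^sup>2)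
           \<le> (1 + \<alpha>\<^sup>2 / (2 * \<alpha> - 1)) / real (Suc n)"
proof -
  let ?d = "\<lambda>k. (cesaro_weight \<alpha> n k - cesaro_weight \<alpha> n (Suc k))\<^sup>2"
  have "(\<Sum>k\<le>n. ?d (k + m)) = sum ?d ((\<lambda>k. k + m) ` {..n})"
    by (simp add: sum.reindex)
  also have "\<dots> \<le> sum ?d {..n + m}" by (intro sum_mono2) auto
  also have "\<dots> = sum ?d {..n}"
    by (intro sum.mono_neutral_right) (auto simp: cesaro_weight_def)
  also have "\<dots> \<le> (1 + \<alpha>\<^sup>2 / (2 * \<alpha> - 1)) / real (Suc n)"
    by (rule sum_cesaro_weight_diff_squares_le[OF assms])
  finally show ?thesis by simp
qed

text \<open>The multiplier lemmas with Beta weights, shifted Cesaro weights and terms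
  \<open>b j * \<zeta> ^ j\<close>. The constant is \<open>2 + 2 * C * (1 + B)\<close> with
  \<open>B = 2\<close>; it depends on \<open>\<alpha>\<close> alone, which permits integration over
  \<open>\<zeta>\<close>.\<close>

lemma
  assumes m: "m \<ge> 1" and \<alpha>: "\<alpha> > 1 / 2"
  defines "K \<equiv> 2 + 2 * (1 + \<alpha>\<^sup>2 / (2 * \<alpha> - 1)) * (1 + 2)"
  shows local_dirichlet_cesaro_le:
      "local_dirichlet m (\<lambda>j. cesaro_weight \<alpha> n (j + m) *\<^sub>R b j) \<zeta> \<le> ennreal K * local_dirichlet m b \<zeta>"
    and local_dirichlet_cesaro_tendsto_0:
      "local_dirichlet m b \<zeta> < \<infinity> \<Longrightarrow>
        (\<lambda>n. local_dirichlet m (\<lambda>j. (cesaro_weight \<alpha> n (j + m) - 1) *\<^sub>R b j) \<zeta>) \<longlonglongrightarrow> 0"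
proof -
  let ?w = "\<lambda>k. Beta (real (Suc k)) (real (Suc m))"
  have dec: "decseq ?w" using Beta_Suc_Suc_antimono[OF m] by (intro decseq_SucI)
  have tail: "sum ?w {n<..<N} \<le> 2 * real (Suc n) * ?w n" for n N
  proof -
    have "sum ?w {n<..<N} \<le> sum ?w {n..<N}"
      using Beta_Suc_Suc_pos[OF m] by (intro sum_mono2) (auto simp: less_imp_le)
    with sum_Beta_Suc_Suc_tail_le[OF m, of n N] show ?thesis by linarith
  qed
  have C: "0 \<le> 1 + \<alpha>\<^sup>2 / (2 * \<alpha> - 1)" using \<alpha> by simp
  have w01: "0 \<le> cesaro_weight \<alpha> n k" "cesaro_weight \<alpha> n k \<le> 1" for n k
    using \<alpha> by (simp_all add: cesaro_weight_nonneg cesaro_weight_le_1)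
  have w0: "cesaro_weight \<alpha> n (k + m) = 0" if "n < k" for n k
    using that by (simp add: cesaro_weight_def)
  show "local_dirichlet m (\<lambda>j. cesaro_weight \<alpha> n (j + m) *\<^sub>R b j) \<zeta> \<le> ennreal K * local_dirichlet m b \<zeta>"
    unfolding local_dirichlet_def K_def mult_scaleR_left
    by (rule suminf_multiplier_le[where w = ?w and B = 2 and n = n
          and e = "\<lambda>j. cesaro_weight \<alpha> n (j + m)",
          OF Beta_Suc_Suc_pos[OF m] dec tail _ w01 w0
          sum_shifted_cesaro_weight_diff_squares_le[OF \<alpha>] C]) auto
  show "(\<lambda>n. local_dirichlet m (\<lambda>j. (cesaro_weight \<alpha> n (j + m) - 1) *\<^sub>R b j) \<zeta>) \<longlonglongrightarrow> 0"
    if "local_dirichlet m b \<zeta> < \<infinity>"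
    using that unfolding local_dirichlet_def mult_scaleR_left
    by (intro multiplier_tendsto_0[where w = ?w and B = 2 and b = "\<lambda>j. b j * \<zeta> ^ j"
          and e = "\<lambda>n j. cesaro_weight \<alpha> n (j + m)",
          OF Beta_Suc_Suc_pos[OF m] dec summable_Beta_Suc_Suc[OF m] tail _ w01 w0
          sum_shifted_cesaro_weight_diff_squares_le[OF \<alpha>] C cesaro_weight_tendsto_1[OF \<alpha>]])
      auto
qed

lemma local_dirichlet_diff_le:
  assumes "m \<ge> 1"
  shows "local_dirichlet m (\<lambda>j. b j - c j) \<zeta> \<le> 2 * local_dirichlet m b \<zeta> + 2 * local_dirichlet m c \<zeta>"
  unfolding local_dirichlet_def left_diff_distrib sum_subtractf
  using suminf_ennreal_norm_add_squared_le[of "\<lambda>k. Beta (real (Suc k)) (real (Suc m))"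
      "\<lambda>k. \<Sum>j\<le>k. b j * \<zeta> ^ j" "\<lambda>k. - (\<Sum>j\<le>k. c j * \<zeta> ^ j)",
      OF less_imp_le[OF Beta_Suc_Suc_pos[OF assms]]]
  by (simp only: norm_minus_cancel add_uminus_conv_diff)

section \<open>Integration of the local estimates over the circle\<close>

theorem theorem1p1:
  fixes \<mu> :: "complex measure" and m :: nat and \<alpha> :: real
  assumes "\<mu> \<in> circle_measures" and "m \<ge> 1" and "\<alpha> > 1 / 2"
  shows "(\<exists>\<kappa>::real. \<kappa> > 0 \<and>
            (\<forall>n\<ge>1. \<forall>f \<in> dirichlet_space \<mu> m.
               dirichlet_integral \<mu> m (cesaro_mean \<alpha> n f)
                 \<le> ennreal \<kappa> * dirichlet_integral \<mu> m f)) \<and>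
         (\<forall>f \<in> dirichlet_space \<mu> m.
            (\<lambda>n. dirichlet_integral \<mu> m (\<lambda>z. cesaro_mean \<alpha> n f z - f z)) \<longlonglongrightarrow> 0)"
proof -
  note [measurable] = borel_measurable_local_dirichlet[OF assms(1)]
  define K where "K = 2 + 2 * (1 + \<alpha>\<^sup>2 / (2 * \<alpha> - 1)) * (1 + 2)"
  have K: "K > 0" using assms(3) by (simp add: K_def add_pos_nonneg)
  have le: "local_dirichlet m (\<lambda>j. cesaro_weight \<alpha> n (j + m) *\<^sub>R b j) \<zeta> \<le> ennreal K * local_dirichlet m b \<zeta>" for n b \<zeta>
    unfolding K_def by (rule local_dirichlet_cesaro_le[OF assms(2,3)])
  have hol: "f holomorphic_on ball 0 1" if "f \<in> dirichlet_space \<mu> m" for f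
    using that by (auto simp: dirichlet_space_def hardy_H2_def split: if_splits)
  let ?c = "ennreal (1 / (fact m * fact (m - 1)))"
  have "dirichlet_integral \<mu> m (cesaro_mean \<alpha> n f) \<le> ennreal K * dirichlet_integral \<mu> m f"
    if "f \<in> dirichlet_space \<mu> m" for n f
  proof -
    have "dirichlet_integral \<mu> m (cesaro_mean \<alpha> n f)
        = ?c * (\<integral>\<^sup>+\<zeta>. local_dirichlet m (\<lambda>j. cesaro_weight \<alpha> n (j + m) *\<^sub>R deriv_coeff m f j) \<zeta> \<partial>\<mu>)"
      by (simp add: dirichlet_integral_eq_local[OF assms(1,2) cesaro_mean_holomorphic] deriv_coeff_cesaro_mean)
    also have "\<dots> \<le> ?c * (\<integral>\<^sup>+\<zeta>. ennreal K * local_dirichlet m (deriv_coeff m f) \<zeta> \<partial>\<mu>)"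
      by (intro mult_left_mono nn_integral_mono le) auto
    also have "\<dots> = ennreal K * dirichlet_integral \<mu> m f"
      by (simp add: dirichlet_integral_eq_local[OF assms(1,2) hol[OF that]] nn_integral_cmult mult.left_commute)
    finally show ?thesis .
  qed
  moreover have "(\<lambda>n. dirichlet_integral \<mu> m (\<lambda>z. cesaro_mean \<alpha> n f z - f z)) \<longlonglongrightarrow> 0"
    if f: "f \<in> dirichlet_space \<mu> m" for f
  proof -
    let ?D = "local_dirichlet m (deriv_coeff m f)"
    let ?E = "\<lambda>n. local_dirichlet m (\<lambda>j. (cesaro_weight \<alpha> n (j + m) - 1) *\<^sub>R deriv_coeff m f j)"
    \<comment> \<open>For the zero measure membership only means \<open>H^2\<close>, but then the
      integral is 0; otherwise membership gives finiteness after division by the positive constant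
      \<open>?c\<close>.\<close>
    have fin: "(\<integral>\<^sup>+\<zeta>. ?D \<zeta> \<partial>\<mu>) < \<infinity>"
    proof (cases "\<mu> = null_measure \<mu>")
      case True
      then have "(\<integral>\<^sup>+\<zeta>. ?D \<zeta> \<partial>\<mu>) = 0" by (metis nn_integral_null_measure)
      then show ?thesis by simp
    next
      case False
      then have "dirichlet_integral \<mu> m f < \<infinity>" using f by (simp add: dirichlet_space_def)
      then show ?thesis
        unfolding dirichlet_integral_eq_local[OF assms(1,2) hol[OF f]]
        by (auto simp: ennreal_mult_less_top)
    qed
    have "(\<lambda>n. \<integral>\<^sup>+\<zeta>. ?E n \<zeta> \<partial>\<mu>) \<longlonglongrightarrow> (\<integral>\<^sup>+\<zeta>. 0 \<partial>\<mu>)"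
    proof (rule nn_integral_dominated_convergence[where w = "\<lambda>\<zeta>. (2 * ennreal K + 2) * ?D \<zeta>"])
      \<comment> \<open>The dominating function: the multiplier \<open>cesaro_weight - 1\<close> is
        split, its first part costs \<open>K\<close>, and squaring a difference costs the factors
        2.\<close>
      have "?E n \<zeta> \<le> (2 * ennreal K + 2) * ?D \<zeta>" for n \<zeta>
      proof -
        have "?E n \<zeta> \<le> 2 * local_dirichlet m (\<lambda>j. cesaro_weight \<alpha> n (j + m) *\<^sub>R deriv_coeff m f j) \<zeta> + 2 * ?D \<zeta>"
          using local_dirichlet_diff_le[OF assms(2)] by (simp add: scaleR_diff_left)
        also have "\<dots> \<le> 2 * (ennreal K * ?D \<zeta>) + 2 * ?D \<zeta>"
          by (intro add_mono mult_left_mono le) auto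
        finally show ?thesis by (simp add: distrib_right mult.assoc)
      qed
      then show "AE \<zeta> in \<mu>. ?E n \<zeta> \<le> (2 * ennreal K + 2) * ?D \<zeta>" for n by simp
      show "(\<integral>\<^sup>+\<zeta>. (2 * ennreal K + 2) * ?D \<zeta> \<partial>\<mu>) < \<infinity>"
        using fin by (simp add: nn_integral_cmult ennreal_mult_less_top)
      \<comment> \<open>Pointwise convergence is known only where the local integral is finite,
        which holds almost everywhere by \<open>fin\<close>.\<close>
      have "AE \<zeta> in \<mu>. ?D \<zeta> \<noteq> \<infinity>"
        using fin by (intro nn_integral_PInf_AE) auto
      then show "AE \<zeta> in \<mu>. (\<lambda>n. ?E n \<zeta>) \<longlonglongrightarrow> 0"
        by eventually_elim
          (intro local_dirichlet_cesaro_tendsto_0[OF assms(2,3)], simp add: less_top[symmetric])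
    qed measurable
    then have "(\<lambda>n. ?c * (\<integral>\<^sup>+\<zeta>. ?E n \<zeta> \<partial>\<mu>)) \<longlonglongrightarrow> ?c * 0"
      by (intro ennreal_tendsto_cmult) auto
    moreover have "dirichlet_integral \<mu> m (\<lambda>z. cesaro_mean \<alpha> n f z - f z) = ?c * (\<integral>\<^sup>+\<zeta>. ?E n \<zeta> \<partial>\<mu>)" for n
    proof -
      have "deriv_coeff m (\<lambda>z. cesaro_mean \<alpha> n f z - f z)
          = (\<lambda>j. (cesaro_weight \<alpha> n (j + m) - 1) *\<^sub>R deriv_coeff m f j)"
        by (simp add: fun_eq_iff deriv_coeff_diff[OF cesaro_mean_holomorphic hol[OF f]]
            deriv_coeff_cesaro_mean scaleR_diff_left)
      then show ?thesis
        by (subst dirichlet_integral_eq_local[OF assms(1,2)])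
          (auto intro!: holomorphic_intros cesaro_mean_holomorphic hol[OF f])
    qed
    ultimately show ?thesis by simp
  qed
  ultimately show ?thesis using K by blast
qed

end
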